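(* Let $\widetilde{G}:Sp(2n,\mathbb{R})\to\mathbb{R}$ be a smooth function and let $G:\mathcal{M}_{2n}(\mathbb{R})\to\mathbb{R}$ be a smooth function with $G|_{Sp(2n,\mathbb{R})}=\widetilde{G}$. For every $M\in Sp(2n,\mathbb{R})$, the Hessian of $\widetilde{G}$ with respect to the Riemannian metric induced on $Sp(2n,\mathbb{R})$ by the Euclidean metric of $\mathcal{M}_{2n}(\mathbb{R})$ is given by $$\mathrm{Hess}_{Euc}\widetilde{G}(M)=\left(\mathrm{Hess}_{Euc}G(M)-\widetilde{\Sigma}(M)\otimes J\right)\Big|_{T_MSp(2n,\mathbb{R})\times T_MSp(2n,\mathbb{R})},$$ where $\widetilde{\Sigma}(M)$ is the matrix of Lagrange multipliers defined in the context.
   Context: $\mathcal{M}_{2n}(\mathbb{R})$ is the space of real $2n\times 2n$ matrices with the Euclidean (Frobenius) inner product $\langle X,Y\rangle_{Euc}=\mathrm{tr}(X^TY)$; $\nabla_{Euc}$ is the corresponding gradient. $J=\begin{bmatrix}0&\mathbb{I}_n\\-\mathbb{I}_n&0\end{bmatrix}$ and $Sp(2n,\mathbb{R})=\{M\in\mathcal{M}_{2n}(\mathbb{R}) : M^TJM=J\}$. $\mathrm{Hess}_{Euc}G(M)$ is the ordinary second derivative of $G$ at $M$, viewed as a symmetric bilinear form on $\mathcal{M}_{2n}(\mathbb{R})$; $\mathrm{Hess}_{Euc}\widetilde{G}(M)$ is the Riemannian Hessian (bilinear form on $T_MSp(2n,\mathbb{R})$) of $\widetilde{G}$ for the induced metric.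 For $2n\times 2n$ matrices $X,Y$, the Kronecker product $Y\otimes X$ is identified with the bilinear form $(U,V)\mapsto \mathrm{vec}(U)^T(Y\otimes X)\mathrm{vec}(V)=\mathrm{tr}(U^TXVY^T)$ on $\mathcal{M}_{2n}(\mathbb{R})$, where $\mathrm{vec}$ is column vectorization. Constraint functions. Write $M=\begin{bmatrix}A&B\\C&D\end{bmatrix}$ with $n\times n$ blocks having columns $a_i,b_i,c_i,d_i\in\mathbb{R}^n$ respectively. Put $F^{AC}_{ij}(M)=\langle a_i,c_j\rangle-\langle a_j,c_i\rangle$ and $F^{BD}_{ij}(M)=\langle b_i,d_j\rangle-\langle b_j,d_i\rangle$ for $1\le i<j\le n$, and $F_{ij}(M)=\langle a_i,d_j\rangle-\langle c_i,b_j\rangle-\delta_{ij}$ for $1\le i,j\le n$. These $2n^2-n$ functions are functionally independent and their common zero set is $Sp(2n,\mathbb{R})$. Lagrange multipliers. Enumerate the constraint functions as $F_1,\dots,F_k$, $k=2n^2-n$. The Lagrange multiplier function attached to $F_i$ is $$\sigma^i=\frac{\det\big[\langle\nabla_{Euc}H^{(i)}_q,\nabla_{Euc}F_p\rangle_{Euc}\big]_{p,q=1}^k}{\det\big[\langle\nabla_{Euc}F_q,\nabla_{Euc}F_p\rangle_{Euc}\big]_{p,q=1}^k},$$ where $H^{(i)}_q=F_q$ for $q\ne i$ and $H^{(i)}_i=G$. (Equivalently, at $M\in Sp(2n,\mathbb{R})$ the $\sigma^i(M)$ are the unique coefficients such that $\nabla_{Euc}G(M)-\sum_i\sigma^i(M)\nabla_{Euc}F_i(M)$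 is orthogonal to every $\nabla_{Euc}F_p(M)$.) Denote the multipliers of $F^{AC}_{ij},F^{BD}_{ij},F_{ij}$ by $\sigma^{ij}_{AC},\sigma^{ij}_{BD},\sigma^{ij}$. Let $\Sigma_{AC}$, $\Sigma_{BD}$ be the $n\times n$ skew-symmetric matrices whose $(i,j)$ entries for $i<j$ are $\sigma^{ij}_{AC}$, $\sigma^{ij}_{BD}$, let $\Sigma=[\sigma^{ij}]_{i,j=1}^n$, and let $\widetilde{\Sigma}(M)=\begin{bmatrix}\Sigma_{AC}(M)&\Sigma(M)\\-\Sigma(M)^T&\Sigma_{BD}(M)\end{bmatrix}$, a $2n\times 2n$ skew-symmetric matrix. *)

theory Defs
  imports "HOL-Analysis.Analysis"
begin

text \<open>
  Real \<open>2n \<times> 2n\<close> matrices are indexed by the sum type \<open>'n + 'n\<close> with \<open>CARD('n) = n\<close>, so the four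
  \<open>n \<times> n\<close> blocks are selected by \<open>Inl\<close> and \<open>Inr\<close>. The library inner product of this type is the
  Frobenius inner product \<open>tr (X\<^sup>T Y)\<close>. The order on \<open>'n\<close> serves only to select the pairs \<open>i < j\<close>.
\<close>

type_synonym 'n mat1 = "real ^ 'n ^ 'n"
type_synonym 'n mat2 = "real ^ ('n + 'n) ^ ('n + 'n)"

definition block_matrix ::
    "'n::finite mat1 \<Rightarrow> 'n mat1 \<Rightarrow> 'n mat1 \<Rightarrow> 'n mat1 \<Rightarrow> 'n mat2" where
  "block_matrix A B C D = (\<chi> p q. case (p, q) of
       (Inl i, Inl j) \<Rightarrow> A $ i $ j | (Inl i, Inr j) \<Rightarrow> B $ i $ j
     | (Inr i, Inl j) \<Rightarrow> C $ i $ j | (Inr i, Inr j) \<Rightarrow> D $ i $ j)"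

definition J_mat :: "'n::finite mat2" where
  "J_mat = block_matrix 0 (mat 1) (- mat 1) 0"

definition Sp :: "'n::finite mat2 set" where
  "Sp = {M. transpose M ** J_mat ** M = J_mat}"

section \<open>Smooth maps, gradient and Hessian in Euclidean space\<close>

text \<open>On an open subset of a finite-dimensional space, \<open>Ck_on k\<close> is \<open>k\<close>-fold continuous
  differentiability: all iterated directional derivatives are again differentiable or continuous.\<close>

primrec Ck_on :: "nat \<Rightarrow> 'a set \<Rightarrow> ('a::real_normed_vector \<Rightarrow> 'b::real_normed_vector) \<Rightarrow> bool" where
  "Ck_on 0 S f \<longleftrightarrow> continuous_on S f"
| "Ck_on (Suc k) S f \<longleftrightarrow>
     (\<forall>x\<in>S. f differentiable (at x)) \<and> (\<forall>v. Ck_on k S (\<lambda>x. frechet_derivative f (at x) v))"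

definition smooth_on :: "'a set \<Rightarrow> ('a::real_normed_vector \<Rightarrow> 'b::real_normed_vector) \<Rightarrow> bool" where
  "smooth_on S f \<longleftrightarrow> (\<forall>k. Ck_on k S f)"

definition gradient_Euc :: "('a::real_inner \<Rightarrow> real) \<Rightarrow> 'a \<Rightarrow> 'a" where
  "gradient_Euc f x = (THE g. GDERIV f x :> g)"

definition Hess_Euc :: "('a::real_normed_vector \<Rightarrow> real) \<Rightarrow> 'a \<Rightarrow> 'a \<Rightarrow> 'a \<Rightarrow> real" where
  "Hess_Euc f x u v = frechet_derivative (\<lambda>y. frechet_derivative f (at y) v) (at x) u"

section \<open>The symplectic group as a Riemannian submanifold\<close>

text \<open>Functions and vector fields on \<open>Sp\<close> are represented by functions on all matrices;
  only their values on \<open>Sp\<close> matter. Smoothness on the embedded submanifold \<open>Sp\<close> means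
  local existence of smooth extensions to open sets of matrices.\<close>

definition smooth_on_Sp :: "('n::finite mat2 \<Rightarrow> 'b::real_normed_vector) \<Rightarrow> bool" where
  "smooth_on_Sp f \<longleftrightarrow>
     (\<forall>M\<in>Sp. \<exists>S g. open S \<and> M \<in> S \<and> smooth_on S g \<and> (\<forall>N\<in>S \<inter> Sp. g N = f N))"

definition Sp_curve :: "(real \<Rightarrow> 'n::finite mat2) \<Rightarrow> 'n mat2 \<Rightarrow> 'n mat2 \<Rightarrow> bool" where
  "Sp_curve \<gamma> M U \<longleftrightarrow>
     (\<exists>e>0. smooth_on {-e<..<e} \<gamma> \<and> \<gamma> ` {-e<..<e} \<subseteq> Sp) \<and>
     \<gamma> 0 = M \<and> (\<gamma> has_vector_derivative U) (at 0)"

definition tangent_Sp :: "'n::finite mat2 \<Rightarrow> 'n mat2 set" where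
  "tangent_Sp M = {U. \<exists>\<gamma>. Sp_curve \<gamma> M U}"

text \<open>The derivative \<open>df(M)(U)\<close> of a function on \<open>Sp\<close> along a tangent vector \<open>U\<close> at \<open>M\<close>.\<close>

definition deriv_Sp :: "('n::finite mat2 \<Rightarrow> real) \<Rightarrow> 'n mat2 \<Rightarrow> 'n mat2 \<Rightarrow> real" where
  "deriv_Sp f M U = (THE d. \<forall>\<gamma>. Sp_curve \<gamma> M U \<longrightarrow> ((\<lambda>t. f (\<gamma> t)) has_real_derivative d) (at 0))"

definition vector_field_Sp :: "('n::finite mat2 \<Rightarrow> 'n mat2) \<Rightarrow> bool" where
  "vector_field_Sp X \<longleftrightarrow> smooth_on_Sp X \<and> (\<forall>M\<in>Sp. X M \<in> tangent_Sp M)"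

definition field_deriv ::
    "('n::finite mat2 \<Rightarrow> 'n mat2) \<Rightarrow> ('n mat2 \<Rightarrow> real) \<Rightarrow> 'n mat2 \<Rightarrow> real" where
  "field_deriv X f = (\<lambda>M. deriv_Sp f M (X M))"

definition affine_connection_Sp ::
    "(('n::finite mat2 \<Rightarrow> 'n mat2) \<Rightarrow> ('n mat2 \<Rightarrow> 'n mat2) \<Rightarrow> 'n mat2 \<Rightarrow> 'n mat2) \<Rightarrow> bool" where
  "affine_connection_Sp conn \<longleftrightarrow>
     (\<forall>X Y. vector_field_Sp X \<and> vector_field_Sp Y \<longrightarrow> vector_field_Sp (conn X Y)) \<and>
     (\<forall>X X' Y. vector_field_Sp X \<and> vector_field_Sp X' \<and> vector_field_Sp Y \<longrightarrow>
        (\<forall>M\<in>Sp. conn (\<lambda>N. X N + X' N) Y M = conn X Y M + conn X' Y M)) \<and>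
     (\<forall>f X Y. smooth_on_Sp f \<and> vector_field_Sp X \<and> vector_field_Sp Y \<longrightarrow>
        (\<forall>M\<in>Sp. conn (\<lambda>N. f N *\<^sub>R X N) Y M = f M *\<^sub>R conn X Y M)) \<and>
     (\<forall>X Y Y'. vector_field_Sp X \<and> vector_field_Sp Y \<and> vector_field_Sp Y' \<longrightarrow>
        (\<forall>M\<in>Sp. conn X (\<lambda>N. Y N + Y' N) M = conn X Y M + conn X Y' M)) \<and>
     (\<forall>f X Y. smooth_on_Sp f \<and> vector_field_Sp X \<and> vector_field_Sp Y \<longrightarrow>
        (\<forall>M\<in>Sp. conn X (\<lambda>N. f N *\<^sub>R Y N) M = field_deriv X f M *\<^sub>R Y M + f M *\<^sub>R conn X Y M))"

text \<open>The Levi-Civita axioms for the induced metric. Freeness of torsion, \<open>\<nabla>\<^sub>X Y - \<nabla>\<^sub>Y X = [X, Y]\<close>,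
  is expressed by the action of both sides as derivations on smooth functions.\<close>

definition is_Levi_Civita_Sp ::
    "(('n::finite mat2 \<Rightarrow> 'n mat2) \<Rightarrow> ('n mat2 \<Rightarrow> 'n mat2) \<Rightarrow> 'n mat2 \<Rightarrow> 'n mat2) \<Rightarrow> bool" where
  "is_Levi_Civita_Sp conn \<longleftrightarrow> affine_connection_Sp conn \<and>
     (\<forall>X Y f. vector_field_Sp X \<and> vector_field_Sp Y \<and> smooth_on_Sp f \<longrightarrow>
        (\<forall>M\<in>Sp. field_deriv (\<lambda>N. conn X Y N - conn Y X N) f M
               = field_deriv X (field_deriv Y f) M - field_deriv Y (field_deriv X f) M)) \<and>
     (\<forall>X Y Z. vector_field_Sp X \<and> vector_field_Sp Y \<and> vector_field_Sp Z \<longrightarrow>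
        (\<forall>M\<in>Sp. field_deriv X (\<lambda>N. Y N \<bullet> Z N) M = conn X Y M \<bullet> Z M + Y M \<bullet> conn X Z M))"

text \<open>The axioms determine the connection for vector fields, at points of \<open>Sp\<close>; the choice below
  is arbitrary only in the irrelevant values elsewhere.\<close>

definition Levi_Civita_Sp ::
    "('n::finite mat2 \<Rightarrow> 'n mat2) \<Rightarrow> ('n mat2 \<Rightarrow> 'n mat2) \<Rightarrow> 'n mat2 \<Rightarrow> 'n mat2" where
  "Levi_Civita_Sp = (SOME conn. is_Levi_Civita_Sp conn)"

text \<open>The Riemannian Hessian is the second covariant derivative
  \<open>(X, Y) \<mapsto> X(Y f) - (\<nabla>\<^sub>X Y) f\<close>, whose value at \<open>M\<close> depends on \<open>X(M)\<close> and \<open>Y(M)\<close> only.\<close>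

definition Hess_Sp :: "('n::finite mat2 \<Rightarrow> real) \<Rightarrow> 'n mat2 \<Rightarrow> 'n mat2 \<Rightarrow> 'n mat2 \<Rightarrow> real" where
  "Hess_Sp f M U V = (THE h. \<forall>X Y. vector_field_Sp X \<and> vector_field_Sp Y \<and> X M = U \<and> Y M = V \<longrightarrow>
     h = field_deriv X (field_deriv Y f) M - field_deriv (Levi_Civita_Sp X Y) f M)"

section \<open>Constraint functions and Lagrange multipliers\<close>

datatype 'n constraint_label = AC 'n 'n | BD 'n 'n | AD 'n 'n

text \<open>The type of the \<open>2n\<^sup>2 - n\<close> constraint indices; \<open>AD i j\<close> labels the function \<open>F\<^sub>i\<^sub>j\<close>.\<close>

typedef (overloaded) ('n::"{finite,linorder}") constraint_index =
    "{AC i j |i j::'n. i < j} \<union> {BD i j |i j. i < j} \<union> {AD i j |i j. True}"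
  by blast

instance constraint_index :: ("{finite,linorder}") finite
proof
  have "(UNIV :: 'a constraint_label set)
      = (\<lambda>(i, j). AC i j) ` UNIV \<union> (\<lambda>(i, j). BD i j) ` UNIV \<union> (\<lambda>(i, j). AD i j) ` UNIV"
    by (auto simp: image_iff) (metis constraint_label.exhaust)
  then have "finite (UNIV :: 'a constraint_label set)"
    by (metis finite_Un finite_imageI finite)
  then have "finite (range (Rep_constraint_index :: 'a constraint_index \<Rightarrow> _))"
    using finite_subset subset_UNIV by blast
  then show "finite (UNIV :: 'a constraint_index set)"
    by (rule finite_imageD) (simp add: inj_on_def Rep_constraint_index_inject)
qed

definition block_col_A :: "'n::finite mat2 \<Rightarrow> 'n \<Rightarrow> real ^ 'n" where
  "block_col_A M i = (\<chi> r. M $ Inl r $ Inl i)"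
definition block_col_B :: "'n::finite mat2 \<Rightarrow> 'n \<Rightarrow> real ^ 'n" where
  "block_col_B M i = (\<chi> r. M $ Inl r $ Inr i)"
definition block_col_C :: "'n::finite mat2 \<Rightarrow> 'n \<Rightarrow> real ^ 'n" where
  "block_col_C M i = (\<chi> r. M $ Inr r $ Inl i)"
definition block_col_D :: "'n::finite mat2 \<Rightarrow> 'n \<Rightarrow> real ^ 'n" where
  "block_col_D M i = (\<chi> r. M $ Inr r $ Inr i)"

fun constraint_of_label :: "'n::finite constraint_label \<Rightarrow> 'n mat2 \<Rightarrow> real" where
  "constraint_of_label (AC i j) M =
     block_col_A M i \<bullet> block_col_C M j - block_col_A M j \<bullet> block_col_C M i"
| "constraint_of_label (BD i j) M =
     block_col_B M i \<bullet> block_col_D M j - block_col_B M j \<bullet> block_col_D M i"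
| "constraint_of_label (AD i j) M =
     block_col_A M i \<bullet> block_col_D M j - block_col_C M i \<bullet> block_col_B M j - (if i = j then 1 else 0)"

definition constraint :: "'n::{finite,linorder} constraint_index \<Rightarrow> 'n mat2 \<Rightarrow> real" where
  "constraint c = constraint_of_label (Rep_constraint_index c)"

definition multiplier ::
    "('n::{finite,linorder} mat2 \<Rightarrow> real) \<Rightarrow> 'n constraint_index \<Rightarrow> 'n mat2 \<Rightarrow> real" where
  "multiplier G c M =
     det ((\<chi> p q. gradient_Euc (if q = c then G else constraint q) M
                    \<bullet> gradient_Euc (constraint p) M)
            :: real ^ 'n constraint_index ^ 'n constraint_index)
     / det ((\<chi> p q. gradient_Euc (constraint q) M \<bullet> gradient_Euc (constraint p) M)
            :: real ^ 'n constraint_index ^ 'n constraint_index)"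

definition Sigma_AC :: "('n::{finite,linorder} mat2 \<Rightarrow> real) \<Rightarrow> 'n mat2 \<Rightarrow> 'n mat1" where
  "Sigma_AC G M = (\<chi> i j.
     if i < j then multiplier G (Abs_constraint_index (AC i j)) M
     else if j < i then - multiplier G (Abs_constraint_index (AC j i)) M else 0)"

definition Sigma_BD :: "('n::{finite,linorder} mat2 \<Rightarrow> real) \<Rightarrow> 'n mat2 \<Rightarrow> 'n mat1" where
  "Sigma_BD G M = (\<chi> i j.
     if i < j then multiplier G (Abs_constraint_index (BD i j)) M
     else if j < i then - multiplier G (Abs_constraint_index (BD j i)) M else 0)"

definition Sigma_AD :: "('n::{finite,linorder} mat2 \<Rightarrow> real) \<Rightarrow> 'n mat2 \<Rightarrow> 'n mat1" where
  "Sigma_AD G M = (\<chi> i j. multiplier G (Abs_constraint_index (AD i j)) M)"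

definition Sigma_tilde :: "('n::{finite,linorder} mat2 \<Rightarrow> real) \<Rightarrow> 'n mat2 \<Rightarrow> 'n mat2" where
  "Sigma_tilde G M =
     block_matrix (Sigma_AC G M) (Sigma_AD G M) (- transpose (Sigma_AD G M)) (Sigma_BD G M)"

section \<open>Kronecker products as bilinear forms\<close>

text \<open>Column vectorization: the position of entry \<open>(r, c)\<close> in \<open>vec(U)\<close> is recorded as the pair
  \<open>(c, r)\<close>, so the columns of \<open>U\<close> are stacked in lexicographic order.\<close>

definition vectorize :: "real ^ 'c ^ 'r \<Rightarrow> real ^ ('c::finite \<times> 'r::finite)" where
  "vectorize U = (\<chi> p. U $ snd p $ fst p)"

definition kronecker ::
    "real ^ 'a ^ 'b \<Rightarrow> real ^ 'c ^ 'd \<Rightarrow> real ^ ('a::finite \<times> 'c::finite) ^ ('b::finite \<times> 'd::finite)" where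
  "kronecker Y X = (\<chi> p q. Y $ fst p $ fst q * X $ snd p $ snd q)"

definition kronecker_form ::
    "'n::finite mat2 \<Rightarrow> 'n mat2 \<Rightarrow> 'n mat2 \<Rightarrow> 'n mat2 \<Rightarrow> real" where
  "kronecker_form Y X U V = vectorize U \<bullet> (kronecker Y X *v vectorize V)"

end

theory Submission
  imports Defs
begin

text \<open>
  The connection \<open>\<nabla>\<^sub>X Y = P(DY(X))\<close>, with \<open>P\<close> the orthogonal projection onto the tangent space,
  satisfies the Levi-Civita axioms, and these have a unique solution. For tangent fields \<open>X\<close>, \<open>Y\<close>
  with values \<open>U\<close>, \<open>V\<close> at \<open>M\<close>, the term \<open>dG(DY(U))\<close> of \<open>X(Y G)\<close> therefore cancels in
  \<open>X(Y G) - (\<nabla>\<^sub>X Y) G\<close> up to \<open>dG(N)\<close>, \<open>N\<close> being the normal component of \<open>DY(U)\<close>.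
  The Lagrange multipliers are by Cramer's rule the coefficients of the normal component of
  \<open>\<nabla>G\<close> in the basis \<open>\<nabla>F\<^sub>c\<close>, so \<open>dG(N)\<close> is the sum of the \<open>\<sigma>\<^sup>c \<langle>\<nabla>F\<^sub>c, DY(U)\<rangle>\<close>, and
  differentiating \<open>\<langle>\<nabla>F\<^sub>c, Y\<rangle> = 0\<close> turns it into minus the sum of the
  \<open>\<sigma>\<^sup>c Hess F\<^sub>c(U, V)\<close>. Every \<open>F\<^sub>c\<close> is an entry of \<open>M\<^sup>T J M - J\<close>, whose second
  derivative is the bilinear form \<open>U\<^sup>T J V + V\<^sup>T J U\<close>.
\<close>

section \<open>Shorthand for the Frechet derivative\<close>

abbreviation D :: "('a::real_normed_vector \<Rightarrow> 'b::real_normed_vector) \<Rightarrow> 'a \<Rightarrow> 'a \<Rightarrow> 'b" where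
  "D f x \<equiv> frechet_derivative f (at x)"

lemma D_eqI: "(f has_derivative f') (at x) \<Longrightarrow> D f x v = f' v"
  by (metis frechet_derivative_at)

lemma has_derivative_D: "f differentiable (at x) \<Longrightarrow> (f has_derivative D f x) (at x)"
  by (simp add: frechet_derivative_works)

lemma D_sum_arg:
  assumes "f differentiable (at x)"
  shows "D f x (\<Sum>b\<in>B. c b *\<^sub>R w b) = (\<Sum>b\<in>B. c b *\<^sub>R D f x (w b))"
proof -
  interpret linear "D f x" using assms by (rule linear_frechet_derivative)
  show ?thesis by (simp add: sum scale)
qed

text \<open>\<open>Ck_on\<close> speaks of fixed directions only; this expansion reduces a direction
  that varies with the point to finitely many fixed ones.\<close>

lemma D_Basis_expansion:
  fixes f :: "'a::euclidean_space \<Rightarrow> 'b::real_normed_vector"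
  assumes "f differentiable (at x)"
  shows "D f x v = (\<Sum>b\<in>Basis. (v \<bullet> b) *\<^sub>R D f x b)"
  using D_sum_arg[OF assms, of "\<lambda>b. v \<bullet> b" "\<lambda>b. b" Basis] by (simp add: euclidean_representation)

section \<open>Calculus of smooth maps\<close>

lemma Ck_on_subset: "Ck_on k S f \<Longrightarrow> T \<subseteq> S \<Longrightarrow> Ck_on k T f"
  by (induction k arbitrary: f) (auto intro: continuous_on_subset)

text \<open>On an open set the derivative at a point sees only values inside the set, so agreement
  there passes to all iterated derivatives.\<close>

lemma Ck_on_cong:
  assumes "open S" "\<And>x. x \<in> S \<Longrightarrow> f x = g x" "Ck_on k S f"
  shows "Ck_on k S g"
  using assms(2,3)
proof (induction k arbitrary: f g)
  case 0
  then show ?case by (simp cong: continuous_on_cong)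
next
  case (Suc k)
  have d: "g differentiable (at x)" if "x \<in> S" for x
  proof -
    have "(f has_derivative D f x) (at x)" using Suc.prems(2) that by (simp add: has_derivative_D)
    then have "(g has_derivative D f x) (at x)"
      by (rule has_derivative_transform_within_open[OF _ assms(1) that]) (simp add: Suc.prems)
    then show ?thesis by (auto simp: differentiable_def)
  qed
  have e: "D f x v = D g x v" if "x \<in> S" for x v
    using frechet_derivative_transform_within_open[of f x S g] Suc.prems that assms(1) by auto
  show ?case
    using Suc.IH[of "\<lambda>x. D f x v" "\<lambda>x. D g x v" for v] e d Suc.prems(2) by auto
qed

lemma Ck_on_Suc_imp: "Ck_on (Suc k) S f \<Longrightarrow> Ck_on k S f"
proof (induction k arbitrary: f)
  case 0
  then show ?case
    by (auto intro!: continuous_at_imp_continuous_on differentiable_imp_continuous_within)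
qed auto

lemma Ck_on_const: "Ck_on k S (\<lambda>x. c)"
  by (induction k arbitrary: c) auto

lemma Ck_on_add:
  assumes "open S" "Ck_on k S f" "Ck_on k S g"
  shows "Ck_on k S (\<lambda>x. f x + g x)"
  using assms(2,3)
proof (induction k arbitrary: f g)
  case 0
  then show ?case by (auto intro: continuous_intros)
next
  case (Suc k)
  have e: "D f x v + D g x v = D (\<lambda>x. f x + g x) x v" if "x \<in> S" for x v
    using Suc.prems that
    by (intro D_eqI[symmetric]) (auto intro!: has_derivative_add has_derivative_D)
  have c: "Ck_on k S (\<lambda>x. D f x v + D g x v)" for v
    using Suc.prems by (auto intro: Suc.IH)
  show ?case
    using Suc.prems Ck_on_cong[OF assms(1) e c] by (simp add: differentiable_add)
qed

text \<open>By the Leibniz rule the directional derivative is a sum of two terms of the same shape,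
  one order lower. The single lemma serves products, scaling, inner products, matrix products and
  \<open>sform\<close>.\<close>

lemma Ck_on_bilinear:
  assumes h: "bounded_bilinear h" and S: "open S" and "Ck_on k S f" "Ck_on k S g"
  shows "Ck_on k S (\<lambda>x. h (f x) (g x))"
  using assms(3,4)
proof (induction k arbitrary: f g)
  case 0
  then show ?case by (auto intro: bounded_bilinear.continuous_on[OF h])
next
  case (Suc k)
  have H: "((\<lambda>x. h (f x) (g x)) has_derivative (\<lambda>v. h (f x) (D g x v) + h (D f x v) (g x))) (at x)"
    if "x \<in> S" for x
    using Suc.prems that by (auto intro!: bounded_bilinear.FDERIV[OF h] has_derivative_D)
  have "Ck_on k S f" "Ck_on k S g" using Suc.prems Ck_on_Suc_imp by blast+
  then have "Ck_on k S (\<lambda>x. h (f x) (D g x v) + h (D f x v) (g x))" for v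
    using Suc.prems by (intro Ck_on_add[OF S] Suc.IH) auto
  then have "Ck_on k S (\<lambda>x. D (\<lambda>x. h (f x) (g x)) x v)" for v
    by (rule Ck_on_cong[OF S, rotated]) (rule D_eqI[OF H, symmetric])
  then show ?case using H by (auto simp: differentiable_def)
qed

lemma Ck_on_bounded_linear:
  assumes "bounded_linear f"
  shows "Ck_on k S f"
proof (cases k)
  case 0
  then show ?thesis by (simp add: linear_continuous_on[OF assms])
next
  case (Suc m)
  have H: "(f has_derivative f) (at x)" for x by (rule bounded_linear_imp_has_derivative[OF assms])
  show ?thesis
    using H by (auto simp: Suc D_eqI[OF H] Ck_on_const differentiable_def)
qed

text \<open>The derivative of 1/f is -(1/f) Df (1/f), in which 1/f reappears; the induction
  hypothesis already gives it the order \<open>k\<close> that this product needs.\<close>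

lemma Ck_on_inverse:
  fixes f :: "'a::real_normed_vector \<Rightarrow> real"
  assumes S: "open S" and "Ck_on k S f" "\<And>x. x \<in> S \<Longrightarrow> f x \<noteq> 0"
  shows "Ck_on k S (\<lambda>x. inverse (f x))"
  using assms(2)
proof (induction k)
  case 0
  then show ?case using assms(3) by (auto intro: continuous_intros)
next
  case (Suc k)
  have H: "((\<lambda>x. inverse (f x)) has_derivative
      (\<lambda>v. - (inverse (f x) * (D f x v) * inverse (f x)))) (at x)" if "x \<in> S" for x
    using Suc.prems that assms(3) by (intro Deriv.has_derivative_inverse has_derivative_D) auto
  have i: "Ck_on k S (\<lambda>x. inverse (f x))" using Suc Ck_on_Suc_imp by blast
  have c: "Ck_on k S (\<lambda>x. (-1) * ((inverse (f x) * (D f x v)) * inverse (f x)))" for v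
    using Suc.prems i by (intro Ck_on_bilinear[OF bounded_bilinear_mult S] Ck_on_const) auto
  have "Ck_on k S (\<lambda>x. D (\<lambda>x. inverse (f x)) x v)" for v
    by (rule Ck_on_cong[OF S _ c[of v]]) (simp add: D_eqI[OF H])
  then show ?case using H by (auto simp: differentiable_def)
qed

lemma smooth_on_subset: "smooth_on S f \<Longrightarrow> T \<subseteq> S \<Longrightarrow> smooth_on T f"
  by (auto simp: smooth_on_def intro: Ck_on_subset)

lemma smooth_on_const: "smooth_on S (\<lambda>x. c)"
  by (simp add: smooth_on_def Ck_on_const)

lemma smooth_on_add:
  "open S \<Longrightarrow> smooth_on S f \<Longrightarrow> smooth_on S g \<Longrightarrow> smooth_on S (\<lambda>x. f x + g x)"
  by (simp add: smooth_on_def Ck_on_add)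

lemma smooth_on_bilinear:
  "bounded_bilinear h \<Longrightarrow> open S \<Longrightarrow> smooth_on S f \<Longrightarrow> smooth_on S g \<Longrightarrow>
    smooth_on S (\<lambda>x. h (f x) (g x))"
  by (simp add: smooth_on_def Ck_on_bilinear)

lemmas smooth_on_mult = smooth_on_bilinear[OF bounded_bilinear_mult]
lemmas smooth_on_scaleR = smooth_on_bilinear[OF bounded_bilinear_scaleR]
lemmas smooth_on_inner = smooth_on_bilinear[OF bounded_bilinear_inner]

lemma smooth_on_diff:
  assumes "open S" "smooth_on S f" "smooth_on S g"
  shows "smooth_on S (\<lambda>x. f x - g x)"
  using smooth_on_add[OF assms(1,2) smooth_on_scaleR[OF assms(1) smooth_on_const[of S "-1"] assms(3)]]
  by simp

lemma smooth_on_bounded_linear: "bounded_linear f \<Longrightarrow> smooth_on S f"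
  by (simp add: smooth_on_def Ck_on_bounded_linear)

lemma smooth_on_divide:
  fixes f g :: "'a::real_normed_vector \<Rightarrow> real"
  assumes "open S" "smooth_on S f" "smooth_on S g" "\<And>x. x \<in> S \<Longrightarrow> g x \<noteq> 0"
  shows "smooth_on S (\<lambda>x. f x / g x)"
  unfolding divide_inverse
  using assms by (intro smooth_on_mult) (auto simp: smooth_on_def Ck_on_inverse)

lemma smooth_on_sum:
  assumes "open S" "\<And>i. i \<in> I \<Longrightarrow> smooth_on S (f i)"
  shows "smooth_on S (\<lambda>x. \<Sum>i\<in>I. f i x)"
  using assms(2)
  by (induction I rule: infinite_finite_induct) (auto intro!: smooth_on_add[OF assms(1)] smooth_on_const)

lemma smooth_on_prod:
  fixes f :: "'i \<Rightarrow> 'a::real_normed_vector \<Rightarrow> real"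
  assumes "open S" "\<And>i. i \<in> I \<Longrightarrow> smooth_on S (f i)"
  shows "smooth_on S (\<lambda>x. \<Prod>i\<in>I. f i x)"
  using assms(2)
  by (induction I rule: infinite_finite_induct) (auto intro!: smooth_on_mult[OF assms(1)] smooth_on_const)

lemma smooth_on_det:
  fixes A :: "'a::real_normed_vector \<Rightarrow> 'i::finite \<Rightarrow> 'i \<Rightarrow> real"
  assumes "open S" "\<And>i j. smooth_on S (\<lambda>x. A x i j)"
  shows "smooth_on S (\<lambda>x. det (\<chi> i j. A x i j))"
  unfolding det_def vec_lambda_beta
  by (intro smooth_on_sum[OF assms(1)] smooth_on_mult[OF assms(1)] smooth_on_prod[OF assms(1)]
      smooth_on_const assms(2))

lemma smooth_on_differentiable: "smooth_on S f \<Longrightarrow> x \<in> S \<Longrightarrow> f differentiable (at x)"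
  unfolding smooth_on_def by (metis Ck_on.simps(2))

lemma smooth_on_D_fixed: "smooth_on S f \<Longrightarrow> smooth_on S (\<lambda>x. D f x v)"
  unfolding smooth_on_def by (metis Ck_on.simps(2))

lemma smooth_on_continuous: "smooth_on S f \<Longrightarrow> continuous_on S f"
  unfolding smooth_on_def by (metis Ck_on.simps(1))

lemma smooth_on_cong:
  "open S \<Longrightarrow> (\<And>x. x \<in> S \<Longrightarrow> f x = g x) \<Longrightarrow> smooth_on S f \<Longrightarrow> smooth_on S g"
  unfolding smooth_on_def using Ck_on_cong by blast

lemma smooth_on_D:
  fixes f :: "'a::euclidean_space \<Rightarrow> 'b::real_normed_vector"
  assumes "open S" "smooth_on S f" "smooth_on S X"
  shows "smooth_on S (\<lambda>x. D f x (X x))"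
proof -
  have "smooth_on S (\<lambda>x. \<Sum>b\<in>Basis. (X x \<bullet> b) *\<^sub>R D f x b)"
    by (intro smooth_on_sum smooth_on_scaleR smooth_on_inner smooth_on_const smooth_on_D_fixed assms)
  then show ?thesis
    by (rule smooth_on_cong[OF assms(1), rotated])
      (rule D_Basis_expansion[symmetric], use assms smooth_on_differentiable in blast)
qed

text \<open>After expansion over \<open>Basis\<close> the product rule separates the motion of the
  base point, which gives the second derivative, from the motion of the direction. This underlies
  both X(Y f) and the differentiated tangency condition.\<close>

lemma D_D_field:
  fixes f :: "'a::euclidean_space \<Rightarrow> 'b::real_normed_vector"
  assumes "open S" "smooth_on S f" "x \<in> S" "X differentiable (at x)"
  shows "((\<lambda>y. D f y (X y)) has_derivative (\<lambda>u. D (\<lambda>y. D f y (X x)) x u + D f x (D X x u))) (at x)"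
proof -
  have fd: "f differentiable (at y)" if "y \<in> S" for y using assms that smooth_on_differentiable by blast
  have f2: "(\<lambda>y. D f y v) differentiable (at x)" for v
    using smooth_on_differentiable[OF smooth_on_D_fixed[OF assms(2)] assms(3)] .
  have 1: "((\<lambda>y. \<Sum>b\<in>Basis. (X y \<bullet> b) *\<^sub>R D f y b) has_derivative
     (\<lambda>u. \<Sum>b\<in>Basis. (X x \<bullet> b) *\<^sub>R D (\<lambda>y. D f y b) x u + (D X x u \<bullet> b) *\<^sub>R D f x b)) (at x)"
    by (auto intro!: derivative_eq_intros has_derivative_D f2 assms(4))
  have 2: "((\<lambda>y. \<Sum>b\<in>Basis. (X x \<bullet> b) *\<^sub>R D f y b) has_derivative
     (\<lambda>u. \<Sum>b\<in>Basis. (X x \<bullet> b) *\<^sub>R D (\<lambda>y. D f y b) x u)) (at x)"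
    by (auto intro!: derivative_eq_intros has_derivative_D f2)
  have 3: "((\<lambda>y. D f y (X x)) has_derivative
     (\<lambda>u. \<Sum>b\<in>Basis. (X x \<bullet> b) *\<^sub>R D (\<lambda>y. D f y b) x u)) (at x)"
    by (rule has_derivative_transform_within_open[OF 2 assms(1,3)])
      (rule D_Basis_expansion[symmetric], rule fd)
  have 4: "((\<lambda>y. D f y (X y)) has_derivative
     (\<lambda>u. \<Sum>b\<in>Basis. (X x \<bullet> b) *\<^sub>R D (\<lambda>y. D f y b) x u + (D X x u \<bullet> b) *\<^sub>R D f x b)) (at x)"
    by (rule has_derivative_transform_within_open[OF 1 assms(1,3)])
      (rule D_Basis_expansion[symmetric], rule fd)
  show ?thesis
    using 4 by (simp add: D_eqI[OF 3] sum.distrib D_Basis_expansion[OF fd[OF assms(3)], of "D X x _"])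
qed

section \<open>Symmetry of second derivatives\<close>

lemma second_difference_mean_value:
  fixes f :: "'a::real_normed_vector \<Rightarrow> real"
  assumes f: "smooth_on S f" and "t > 0"
    and par: "\<And>a b. \<lbrakk>0 \<le> a; a \<le> t; 0 \<le> b; b \<le> t\<rbrakk> \<Longrightarrow> x + a *\<^sub>R u + b *\<^sub>R v \<in> S"
  obtains a b where "0 \<le> a" "a \<le> t" "0 \<le> b" "b \<le> t"
    "f (x + t *\<^sub>R u + t *\<^sub>R v) - f (x + t *\<^sub>R u) - f (x + t *\<^sub>R v) + f x
      = t * t * D (\<lambda>y. D f y u) (x + a *\<^sub>R u + b *\<^sub>R v) v"
proof -
  have deriv: "((\<lambda>s. g (p + s *\<^sub>R w)) has_real_derivative D g (p + s *\<^sub>R w) w) (at s)"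
    if "smooth_on S g" "p + s *\<^sub>R w \<in> S" for g :: "'a \<Rightarrow> real" and p w s
  proof -
    have G: "(g has_derivative D g (p + s *\<^sub>R w)) (at (p + s *\<^sub>R w))"
      using that smooth_on_differentiable has_derivative_D by blast
    have "((\<lambda>s. p + s *\<^sub>R w) has_derivative (\<lambda>h. h *\<^sub>R w)) (at s)"
      by (auto intro!: derivative_eq_intros)
    from has_derivative_compose[OF this G] 
    show ?thesis
      by (rule has_derivative_imp_has_field_derivative)
       (simp add: linear_cmul[OF linear_frechet_derivative] smooth_on_differentiable[OF that])
  qed
  \<comment> \<open>The second difference is \<open>p t - p 0\<close>: one mean value theorem in the
    direction \<open>u\<close> for \<open>p\<close>, and a second one in the direction
    \<open>v\<close> for the derivative so obtained.\<close>
  define p where "p a = f (x + a *\<^sub>R u + t *\<^sub>R v) - f (x + a *\<^sub>R u)" for a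
  have dp: "(p has_real_derivative
      (D f (x + a *\<^sub>R u + t *\<^sub>R v) u - D f (x + a *\<^sub>R u) u)) (at a)"
    if "0 \<le> a" "a \<le> t" for a
  proof -
    have 1: "x + t *\<^sub>R v + a *\<^sub>R u \<in> S" "x + a *\<^sub>R u \<in> S"
      using par[of a t] par[of a 0] that \<open>t > 0\<close> by (auto simp: add_ac)
    show ?thesis
      unfolding p_def using DERIV_diff[OF deriv[OF f 1(1)] deriv[OF f 1(2)]] by (simp add: add_ac)
  qed
  obtain a where a: "0 < a" "a < t"
    "p t - p 0 = (t - 0) * (D f (x + a *\<^sub>R u + t *\<^sub>R v) u - D f (x + a *\<^sub>R u) u)"
    using MVT2[of 0 t p, OF \<open>t > 0\<close> dp] by blast
  obtain b where b: "0 < b" "b < t"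
    "D f (x + a *\<^sub>R u + t *\<^sub>R v) u - D f (x + a *\<^sub>R u + 0 *\<^sub>R v) u
      = (t - 0) * D (\<lambda>y. D f y u) (x + a *\<^sub>R u + b *\<^sub>R v) v"
    using MVT2[of 0 t "\<lambda>b. D f (x + a *\<^sub>R u + b *\<^sub>R v) u",
        OF \<open>t > 0\<close> deriv[OF smooth_on_D_fixed[OF f, of u] par[of a]]] a(1,2)
    by auto
  show ?thesis
    by (rule that[of a b]) (use a b \<open>t > 0\<close> in \<open>auto simp: p_def\<close>)
qed

text \<open>The second difference over a small parallelogram equals t^2 times either mixed
  derivative, each at some nearby point. If the two differed at \<open>x\<close>, continuity would
  keep these values apart.\<close>

lemma D_D_symmetric:
  fixes f :: "'a::real_normed_vector \<Rightarrow> real"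
  assumes S: "open S" and f: "smooth_on S f" and x: "x \<in> S"
  shows "D (\<lambda>y. D f y u) x v = D (\<lambda>y. D f y v) x u"
proof (rule ccontr)
  define P where "P y = D (\<lambda>y. D f y u) y v" for y
  define Q where "Q y = D (\<lambda>y. D f y v) y u" for y
  assume "\<not> ?thesis"
  then have e: "\<bar>P x - Q x\<bar> / 2 > 0" by (simp add: P_def Q_def)
  have "continuous_on S P" "continuous_on S Q"
    unfolding P_def Q_def by (intro smooth_on_continuous smooth_on_D_fixed f)+
  then have "isCont P x" "isCont Q x"
    using S x continuous_on_eq_continuous_at by blast+
  then have ev: "\<exists>d>0. \<forall>y. dist y x < d \<longrightarrow> dist (P y) (P x) < \<bar>P x - Q x\<bar> / 2"
    "\<exists>d>0. \<forall>y. dist y x < d \<longrightarrow> dist (Q y) (Q x) < \<bar>P x - Q x\<bar> / 2"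
    using e unfolding continuous_at_eps_delta by blast+
  obtain d1 where d1: "d1 > 0" "\<And>y. dist y x < d1 \<Longrightarrow> dist (P y) (P x) < \<bar>P x - Q x\<bar> / 2"
    using ev(1) by blast
  obtain d2 where d2: "d2 > 0" "\<And>y. dist y x < d2 \<Longrightarrow> dist (Q y) (Q x) < \<bar>P x - Q x\<bar> / 2"
    using ev(2) by blast
  obtain d3 where d3: "d3 > 0" "ball x d3 \<subseteq> S" using S x openE by blast
  define r where "r = min d3 (min d1 d2)"
  \<comment> \<open>The summand 1 keeps the denominator positive when \<open>u\<close> and
    \<open>v\<close> vanish; the factor 2 makes the parallelogram fit strictly inside the ball of
    radius \<open>r\<close>.\<close>
  define t where "t = r / (2 * (norm u + norm v + 1))"
  have n0: "norm u + norm v + 1 > 0" by (simp add: add_nonneg_pos)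
  have r: "r > 0" using d1 d2 d3 by (simp add: r_def)
  then have t: "t > 0" using n0 by (simp add: t_def)
  have tn: "t * (norm u + norm v) < r"
  proof -
    have "t * (norm u + norm v) \<le> t * (norm u + norm v + 1)" using t by simp
    also have "\<dots> = r / 2" using n0 unfolding t_def by (simp add: divide_simps)
    finally show ?thesis using r by simp
  qed
  have near: "dist (x + a *\<^sub>R u + b *\<^sub>R v) x < r" if "0 \<le> a" "a \<le> t" "0 \<le> b" "b \<le> t" for a b
  proof -
    have "norm (a *\<^sub>R u + b *\<^sub>R v) \<le> a * norm u + b * norm v"
      using norm_triangle_ineq[of "a *\<^sub>R u" "b *\<^sub>R v"] that by simp
    also have "\<dots> \<le> t * norm u + t * norm v"
      using that by (intro add_mono mult_right_mono) auto
    finally show ?thesis using tn by (simp add: dist_norm algebra_simps)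
  qed
  have inS: "x + a *\<^sub>R u + b *\<^sub>R v \<in> S" if "0 \<le> a" "a \<le> t" "0 \<le> b" "b \<le> t" for a b
    using near[OF that] d3 by (auto simp: r_def dist_commute)
  have inS': "x + a *\<^sub>R v + b *\<^sub>R u \<in> S" if "0 \<le> a" "a \<le> t" "0 \<le> b" "b \<le> t" for a b
    using inS[of b a] that by (simp add: add_ac)
  obtain a b where ab: "0 \<le> a" "a \<le> t" "0 \<le> b" "b \<le> t"
    "f (x + t *\<^sub>R u + t *\<^sub>R v) - f (x + t *\<^sub>R u) - f (x + t *\<^sub>R v) + f x
      = t * t * P (x + a *\<^sub>R u + b *\<^sub>R v)"
    unfolding P_def by (rule second_difference_mean_value[OF f t inS])
  obtain a' b' where ab': "0 \<le> a'" "a' \<le> t" "0 \<le> b'" "b' \<le> t"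
    "f (x + t *\<^sub>R v + t *\<^sub>R u) - f (x + t *\<^sub>R v) - f (x + t *\<^sub>R u) + f x
      = t * t * Q (x + a' *\<^sub>R v + b' *\<^sub>R u)"
    unfolding Q_def by (rule second_difference_mean_value[OF f t inS'])
  have *: "x + t *\<^sub>R v + t *\<^sub>R u = x + t *\<^sub>R u + t *\<^sub>R v" by simp
  have "t * t * P (x + a *\<^sub>R u + b *\<^sub>R v) = t * t * Q (x + a' *\<^sub>R v + b' *\<^sub>R u)"
    using ab(5) ab'(5) unfolding * by linarith
  then have eq: "P (x + a *\<^sub>R u + b *\<^sub>R v) = Q (x + b' *\<^sub>R u + a' *\<^sub>R v)"
    using t by (simp add: add_ac)
  have "dist (P (x + a *\<^sub>R u + b *\<^sub>R v)) (P x) < \<bar>P x - Q x\<bar> / 2"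
    using near[OF ab(1-4)] by (intro d1) (simp add: r_def)
  moreover have "dist (Q (x + b' *\<^sub>R u + a' *\<^sub>R v)) (Q x) < \<bar>P x - Q x\<bar> / 2"
    using near[OF ab'(3,4,1,2)] by (intro d2) (simp add: r_def)
  \<comment> \<open>A single number cannot lie within less than half the distance of both
    \<open>p\<close> and \<open>q\<close>; by \<open>eq\<close> the two nearby values are one
    number.\<close>
  moreover have False if "dist a p < \<bar>p - q\<bar> / 2" "dist a q < \<bar>p - q\<bar> / 2" for a p q :: real
    using that dist_triangle3[of p q a] by (simp add: dist_real_def[of p q])
  ultimately show False unfolding eq by blast
qed

section \<open>Gradients\<close>

lemma gradient_Euc_eq:
  fixes f :: "'a::euclidean_space \<Rightarrow> real"
  assumes "f differentiable (at x)"
  shows "gradient_Euc f x = (\<Sum>b\<in>Basis. D f x b *\<^sub>R b)"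
proof -
  define g where "g = (\<Sum>b\<in>Basis. D f x b *\<^sub>R b)"
  have g: "h \<bullet> g = D f x h" for h
    unfolding D_Basis_expansion[OF assms, of h] g_def
    by (simp only: inner_sum_right inner_scaleR_right real_scaleR_def mult.commute)
  have "GDERIV f x :> g"
    using has_derivative_D[OF assms] by (simp add: gderiv_def g)
  moreover have "g' = g" if "GDERIV f x :> g'" for g'
  proof -
    have "h \<bullet> g' = h \<bullet> g" for h
      using D_eqI[OF that[unfolded gderiv_def]] g by metis
    then show ?thesis by (metis inner_commute vector_eq_rdot)
  qed
  ultimately show ?thesis unfolding gradient_Euc_def g_def[symmetric] by (rule the_equality)
qed

lemma gradient_Euc_inner:
  fixes f :: "'a::euclidean_space \<Rightarrow> real"
  assumes "f differentiable (at x)"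
  shows "gradient_Euc f x \<bullet> h = D f x h"
  unfolding gradient_Euc_eq[OF assms] D_Basis_expansion[OF assms, of h] inner_sum_left
  by (intro sum.cong) (auto simp: inner_commute)

text \<open>The definite description is replaced by its sum over \<open>Basis\<close>, whose
  coefficients are derivatives in fixed directions.\<close>

lemma smooth_on_gradient_Euc:
  fixes f :: "'a::euclidean_space \<Rightarrow> real"
  assumes "open S" "smooth_on S f"
  shows "smooth_on S (gradient_Euc f)"
proof -
  have "smooth_on S (\<lambda>x. \<Sum>b\<in>Basis. D f x b *\<^sub>R b)"
    by (intro smooth_on_sum smooth_on_scaleR smooth_on_const smooth_on_D_fixed assms)
  then show ?thesis
    by (rule smooth_on_cong[OF assms(1), rotated])
      (use gradient_Euc_eq assms smooth_on_differentiable in metis)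
qed

section \<open>The symplectic form on columns\<close>

text \<open>Entry (p, q) is the symplectic pairing of column p of U with column q of V. Bilinearity
  lets the Leibniz rule handle the quadratic equation of the group.\<close>

definition sform :: "'n::finite mat2 \<Rightarrow> 'n mat2 \<Rightarrow> 'n mat2" where
  "sform U V = transpose U ** J_mat ** V"

lemma sum_UNIV_Plus:
  fixes f :: "'a::finite + 'b::finite \<Rightarrow> 'c::comm_monoid_add"
  shows "(\<Sum>p\<in>UNIV. f p) = (\<Sum>i\<in>UNIV. f (Inl i)) + (\<Sum>i\<in>UNIV. f (Inr i))"
  using sum.Plus[of "UNIV :: 'a set" "UNIV :: 'b set" f] by (simp add: UNIV_Plus_UNIV)

lemma J_mat_nth [simp]:
  "J_mat $ Inl i $ Inl j = 0" "J_mat $ Inr i $ Inr j = 0"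
  "J_mat $ Inl i $ Inr j = (if i = j then 1 else 0)"
  "J_mat $ Inr i $ Inl j = (if i = j then -1 else 0)"
  by (auto simp: J_mat_def block_matrix_def mat_def)

lemma J_mat_skew: "J_mat $ q $ p = - J_mat $ p $ q"
  by (cases p; cases q) auto

lemma transpose_J_mat: "transpose J_mat = - J_mat"
  by (simp add: vec_eq_iff transpose_def J_mat_skew[symmetric])

lemma J_mat_square: "J_mat ** J_mat = - mat 1"
proof -
  have "(J_mat ** J_mat) $ p $ q = (- mat 1) $ p $ q" for p q :: "'a::finite + 'a"
    by (cases p; cases q) (auto simp: matrix_matrix_mult_def sum_UNIV_Plus mat_def
        if_distrib[of "\<lambda>x. x * _"] if_distrib[of "\<lambda>x. _ * x"] cong: if_cong)
  then show ?thesis by (simp add: vec_eq_iff)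
qed

lemma sform_nth:
  "sform U V $ p $ q =
    (\<Sum>k\<in>UNIV. U $ Inl k $ p * V $ Inr k $ q - U $ Inr k $ p * V $ Inl k $ q)"
  unfolding sform_def
  by (simp add: matrix_matrix_mult_def transpose_def sum_UNIV_Plus sum_subtractf sum_negf
       if_distrib[of "\<lambda>x. x * _"] if_distrib[of "\<lambda>x. _ * x"] cong: if_cong)

lemma sform_swap: "sform V U $ q $ p = - sform U V $ p $ q"
  by (simp add: sform_nth sum_negf[symmetric] mult.commute)

lemma bounded_bilinear_sform: "bounded_bilinear sform"
  unfolding bilinear_conv_bounded_bilinear[symmetric] bilinear_def
  by (auto intro!: linearI simp: vec_eq_iff sform_nth algebra_simps sum.distrib sum_subtractf
      sum_distrib_left sum_negf)

interpretation sform: bounded_bilinear sform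
  by (rule bounded_bilinear_sform)

lemma bounded_bilinear_matrix_mult:
  "bounded_bilinear ((**) :: real ^ 'n::finite ^ 'm::finite \<Rightarrow> real ^ 'p::finite ^ 'n \<Rightarrow> _)"
  unfolding bilinear_conv_bounded_bilinear[symmetric] bilinear_def
  by (auto intro!: linearI simp: vec_eq_iff matrix_matrix_mult_def algebra_simps sum.distrib
      sum_distrib_left)

interpretation matrix_mult: bounded_bilinear
  "(**) :: real ^ 'n::finite ^ 'm::finite \<Rightarrow> real ^ 'p::finite ^ 'n \<Rightarrow> _"
  by (rule bounded_bilinear_matrix_mult)

lemma Sp_iff: "M \<in> Sp \<longleftrightarrow> sform M M = J_mat"
  by (simp add: Sp_def sform_def)

lemma sform_mult: "sform (A ** U) (B ** V) = transpose U ** sform A B ** V"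
  by (simp add: sform_def matrix_transpose_mul matrix_mul_assoc)

lemma Sp_mult: "M \<in> Sp \<Longrightarrow> N \<in> Sp \<Longrightarrow> M ** N \<in> Sp"
  by (simp add: Sp_iff sform_mult) (simp add: sform_def)

text \<open>Multiplying M^T J M = J by -J exhibits -J M^T J as a left inverse, because J^2 = -1; for
  square matrices one-sided inverses are two-sided.\<close>

lemma Sp_inverse:
  assumes "M \<in> Sp"
  obtains M' where "M ** M' = mat 1"
proof -
  have "(- (J_mat ** transpose M ** J_mat)) ** M = - (J_mat ** sform M M)"
    by (simp add: sform_def matrix_mul_assoc matrix_mult.minus_left)
  also have "\<dots> = mat 1" using assms by (simp add: Sp_iff J_mat_square)
  finally show ?thesis using that matrix_left_right_inverse by blast
qed

section \<open>The positions of the constraints\<close>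

fun label_pos :: "'n constraint_label \<Rightarrow> ('n + 'n) \<times> ('n + 'n)" where
  "label_pos (AC i j) = (Inl i, Inl j)"
| "label_pos (BD i j) = (Inr i, Inr j)"
| "label_pos (AD i j) = (Inl i, Inr j)"

definition pos_row :: "'n::{finite,linorder} constraint_index \<Rightarrow> 'n + 'n" where
  "pos_row c = fst (label_pos (Rep_constraint_index c))"

definition pos_col :: "'n::{finite,linorder} constraint_index \<Rightarrow> 'n + 'n" where
  "pos_col c = snd (label_pos (Rep_constraint_index c))"

text \<open>A strict total order in which every \<open>Inl\<close> precedes every
  \<open>Inr\<close>; it selects one of the positions (p, q) and (q, p) off the diagonal.\<close>

fun upper :: "'n::linorder + 'n \<Rightarrow> 'n + 'n \<Rightarrow> bool" where
  "upper (Inl i) (Inl j) \<longleftrightarrow> i < j"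
| "upper (Inr i) (Inr j) \<longleftrightarrow> i < j"
| "upper (Inl i) (Inr j) \<longleftrightarrow> True"
| "upper (Inr i) (Inl j) \<longleftrightarrow> False"

lemma upper_cases: "p = q \<or> upper p q \<or> upper q p"
  by (cases p; cases q) auto

lemma upper_asym: "upper p q \<Longrightarrow> \<not> upper q p"
  by (cases p; cases q) auto

text \<open>The constraints correspond to the independent entries of a skew-symmetric matrix, which
  is why sums over constraints can be traded for sums over entries.\<close>

lemma bij_betw_pos:
  "bij_betw (\<lambda>c :: 'n::{finite,linorder} constraint_index. (pos_row c, pos_col c)) UNIV
    {(p, q). upper p q}"
proof (rule bij_betw_imageI)
  have inj: "k = l" if "label_pos k = label_pos l" for k l :: "'n constraint_label"
    using that by (cases k; cases l) auto
  show "inj (\<lambda>c :: 'n constraint_index. (pos_row c, pos_col c))"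
  proof (rule injI)
    fix c d :: "'n constraint_index"
    assume "(pos_row c, pos_col c) = (pos_row d, pos_col d)"
    then have "label_pos (Rep_constraint_index c) = label_pos (Rep_constraint_index d)"
      by (simp add: pos_row_def pos_col_def)
    then show "c = d" using inj Rep_constraint_index_inject by blast
  qed
  have "upper (pos_row c) (pos_col c)" for c :: "'n constraint_index"
    using Rep_constraint_index[of c] by (auto simp: pos_row_def pos_col_def)
  moreover have "\<exists>c. p = pos_row c \<and> q = pos_col c" if "upper p q" for p q :: "'n + 'n"
  proof -
    \<comment> \<open>The \<open>undefined\<close> branch is the lower left block, which
      \<open>upper p q\<close> rules out.\<close>
    define l where "l = (case p of
        Inl i \<Rightarrow> (case q of Inl j \<Rightarrow> AC i j | Inr j \<Rightarrow> AD i j)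
      | Inr i \<Rightarrow> (case q of Inl j \<Rightarrow> undefined | Inr j \<Rightarrow> BD i j))"
    have "label_pos l = (p, q)"
      "l \<in> {AC i j |i j. i < j} \<union> {BD i j |i j. i < j} \<union> {AD i j |i j. True}"
      using that by (cases p; cases q; simp add: l_def)+
    then have "p = pos_row (Abs_constraint_index l)" "q = pos_col (Abs_constraint_index l)"
      by (simp_all add: pos_row_def pos_col_def Abs_constraint_index_inverse)
    then show ?thesis by blast
  qed
  ultimately show "range (\<lambda>c :: 'n constraint_index. (pos_row c, pos_col c)) = {(p, q). upper p q}"
    by (auto simp: image_iff)
qed

text \<open>The entry of J supplies the Kronecker delta for the labels \<open>AD\<close> and
  vanishes at the positions of \<open>AC\<close> and \<open>BD\<close>.\<close>

lemma constraint_eq: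
  "constraint c M = sform M M $ pos_row c $ pos_col c - J_mat $ pos_row c $ pos_col c"
  using Rep_constraint_index[of c]
  by (auto simp: constraint_def pos_row_def pos_col_def sform_nth sum_subtractf inner_vec_def
      block_col_A_def block_col_B_def block_col_C_def block_col_D_def mult.commute)

text \<open>The block shape of \<open>Sigma_tilde\<close> freed from the multipliers, because the
  dual system of the normals needs it with arbitrary coefficients.\<close>

definition skew_fill :: "('n::{finite,linorder} constraint_index \<Rightarrow> real) \<Rightarrow> 'n mat2" where
  "skew_fill s = block_matrix
    (\<chi> i j. if i < j then s (Abs_constraint_index (AC i j))
            else if j < i then - s (Abs_constraint_index (AC j i)) else 0)
    (\<chi> i j. s (Abs_constraint_index (AD i j)))
    (- transpose (\<chi> i j. s (Abs_constraint_index (AD i j))))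
    (\<chi> i j. if i < j then s (Abs_constraint_index (BD i j))
            else if j < i then - s (Abs_constraint_index (BD j i)) else 0)"

lemma Sigma_tilde_eq: "Sigma_tilde G M = skew_fill (\<lambda>c. multiplier G c M)"
  by (simp add: Sigma_tilde_def skew_fill_def Sigma_AC_def Sigma_BD_def Sigma_AD_def)

lemma skew_fill_skew: "skew_fill s $ q $ p = - skew_fill s $ p $ q"
  by (cases p; cases q) (auto simp: skew_fill_def block_matrix_def transpose_def)

lemma skew_fill_nth [simp]: "skew_fill s $ pos_row c $ pos_col c = s c"
proof -
  define l where "l = Rep_constraint_index c"
  have "c = Abs_constraint_index l" by (simp add: l_def Rep_constraint_index_inverse)
  then show ?thesis
    using Rep_constraint_index[of c] unfolding pos_row_def pos_col_def l_def[symmetric]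
    by (auto simp: skew_fill_def block_matrix_def)
qed

lemma skew_eq_0I:
  assumes "\<And>p q. K $ q $ p = - K $ p $ q" "\<And>c. K $ pos_row c $ pos_col c = 0"
  shows "K = (0 :: 'n::{finite,linorder} mat2)"
proof -
  have u: "K $ p $ q = 0" if "upper p q" for p q
  proof -
    have "(p, q) \<in> range (\<lambda>c. (pos_row c, pos_col c))"
      using that by (simp add: bij_betw_imp_surj_on[OF bij_betw_pos])
    then show ?thesis using assms(2) by auto
  qed
  have "K $ p $ q = 0" for p q
    using upper_cases[of p q] u[of p q] u[of q p] assms(1)[of p q] assms(1)[of p p] by fastforce
  then show ?thesis by (simp add: vec_eq_iff)
qed

text \<open>The diagonal contributes nothing, and the positions (p, q) and (q, p) carry the same
  coefficient up to sign, so each pair collapses to one constraint.\<close>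

lemma sum_skew_fill:
  fixes s :: "'n::{finite,linorder} constraint_index \<Rightarrow> real"
  shows "(\<Sum>p\<in>UNIV. \<Sum>q\<in>UNIV. skew_fill s $ p $ q * w p q)
    = (\<Sum>c\<in>UNIV. s c * (w (pos_row c) (pos_col c) - w (pos_col c) (pos_row c)))"
proof -
  let ?K = "skew_fill s" and ?L = "{(p :: 'n + 'n, q). upper p q}"
    and ?L' = "{(p :: 'n + 'n, q). upper q p}"
  have diag: "?K $ p $ p = 0" for p using skew_fill_skew[of s p p] by simp
  have "(\<Sum>p\<in>UNIV. \<Sum>q\<in>UNIV. ?K $ p $ q * w p q) = (\<Sum>(p, q)\<in>UNIV. ?K $ p $ q * w p q)"
    by (simp add: sum.cartesian_product)
  also have "\<dots> = (\<Sum>(p, q)\<in>?L \<union> ?L'. ?K $ p $ q * w p q)"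
  proof (rule sum.mono_neutral_right)
    show "\<forall>i\<in>UNIV - (?L \<union> ?L'). (case i of (p, q) \<Rightarrow> ?K $ p $ q * w p q) = 0"
    proof
      fix i assume i: "i \<in> UNIV - (?L \<union> ?L')"
      obtain p q where pq: "i = (p, q)" by (cases i)
      with i upper_cases[of p q] have "p = q" by simp
      then show "(case i of (p, q) \<Rightarrow> ?K $ p $ q * w p q) = 0" by (simp add: pq diag)
    qed
  qed auto
  also have "\<dots> = (\<Sum>(p, q)\<in>?L. ?K $ p $ q * w p q) + (\<Sum>(p, q)\<in>?L'. ?K $ p $ q * w p q)"
    by (rule sum.union_disjoint) (use upper_asym in auto)
  also have "(\<Sum>(p, q)\<in>?L'. ?K $ p $ q * w p q) = (\<Sum>(p, q)\<in>?L. ?K $ q $ p * w q p)"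
    by (rule sum.reindex_bij_witness[of _ prod.swap prod.swap]) auto
  also have "(\<Sum>(p, q)\<in>?L. ?K $ p $ q * w p q) + \<dots> = (\<Sum>(p, q)\<in>?L. ?K $ p $ q * (w p q - w q p))"
  proof -
    have "?K $ q $ p * w q p = - (?K $ p $ q * w q p)" for p q
      by (simp add: skew_fill_skew[of s q p])
    then show ?thesis by (simp add: sum.distrib[symmetric] case_prod_unfold algebra_simps)
  qed
  also have "\<dots> = (\<Sum>c\<in>UNIV. s c * (w (pos_row c) (pos_col c) - w (pos_col c) (pos_row c)))"
    using sum.reindex_bij_betw[OF bij_betw_pos,
        of "\<lambda>(p, q). ?K $ p $ q * (w p q - w q p)", symmetric] by simp
  finally show ?thesis .
qed

text \<open>Summing over the row indices first leaves the entries of U^T J V weighted by the skew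
  matrix. Their antisymmetrization is U^T J V + V^T J U by \<open>sform_swap\<close>, the second
  derivative of the constraints.\<close>

lemma kronecker_form_J_skew_fill:
  "kronecker_form (skew_fill s) J_mat U V
    = (\<Sum>c\<in>UNIV. s c * ((sform U V + sform V U) $ pos_row c $ pos_col c))"
proof -
  have J: "(\<Sum>r\<in>UNIV. \<Sum>r'\<in>UNIV. U $ r $ p * (J_mat $ r $ r' * V $ r' $ q)) = sform U V $ p $ q" for p q
    by (simp add: sform_def matrix_matrix_mult_def transpose_def sum_distrib_right sum_distrib_left
        mult_ac) (subst sum.swap, simp)
  have "kronecker_form (skew_fill s) J_mat U V = (\<Sum>p\<in>UNIV. \<Sum>r\<in>UNIV. \<Sum>q\<in>UNIV. \<Sum>r'\<in>UNIV.
      U $ r $ p * (skew_fill s $ p $ q * J_mat $ r $ r' * V $ r' $ q))"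
    unfolding kronecker_form_def
    by (simp add: inner_vec_def vectorize_def kronecker_def matrix_vector_mult_def
        UNIV_Times_UNIV[symmetric] sum.cartesian_product' sum_distrib_left del: UNIV_Times_UNIV)
  also have "\<dots> = (\<Sum>p\<in>UNIV. \<Sum>q\<in>UNIV. \<Sum>r\<in>UNIV. \<Sum>r'\<in>UNIV.
      U $ r $ p * (skew_fill s $ p $ q * J_mat $ r $ r' * V $ r' $ q))"
    by (rule sum.cong[OF refl], rule sum.swap)
  also have "\<dots> = (\<Sum>p\<in>UNIV. \<Sum>q\<in>UNIV. skew_fill s $ p $ q * sform U V $ p $ q)"
    by (simp add: J[symmetric] sum_distrib_left mult_ac)
  finally show ?thesis by (simp add: sum_skew_fill sform_swap[of V U])
qed

section \<open>The normal space\<close>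

abbreviation normal :: "'n::{finite,linorder} constraint_index \<Rightarrow> 'n mat2 \<Rightarrow> 'n mat2" where
  "normal c \<equiv> gradient_Euc (constraint c)"

text \<open>Reading off an entry is pairing with a matrix unit, so the rules for bilinear maps
  suffice.\<close>

lemma smooth_on_constraint: "open S \<Longrightarrow> smooth_on S (constraint c)"
proof -
  assume S: "open S"
  have "smooth_on S (\<lambda>M. sform M M \<bullet> axis (pos_row c) (axis (pos_col c) 1) - J_mat $ pos_row c $ pos_col c)"
    by (intro smooth_on_diff smooth_on_inner smooth_on_const S
        smooth_on_bilinear[OF bounded_bilinear_sform] smooth_on_bounded_linear bounded_linear_ident)
  then show ?thesis by (simp add: constraint_eq[abs_def] inner_axis)
qed

lemma has_derivative_constraint:
  "(constraint c has_derivative (\<lambda>U. (sform U M + sform M U) $ pos_row c $ pos_col c)) (at M)"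
proof -
  have *: "bounded_linear (\<lambda>K :: 'a mat2. K $ pos_row c $ pos_col c)"
    by (rule bounded_linear_compose[OF bounded_linear_vec_nth bounded_linear_vec_nth])
  have "((\<lambda>M. sform M M) has_derivative (\<lambda>U. sform M U + sform U M)) (at M)"
    by (rule sform.FDERIV[OF has_derivative_ident has_derivative_ident])
  from has_derivative_diff[OF bounded_linear.has_derivative[OF * this] has_derivative_const]
  show ?thesis unfolding constraint_eq[abs_def] by (simp add: add.commute)
qed

lemma normal_inner: "normal c M \<bullet> U = (sform U M + sform M U) $ pos_row c $ pos_col c"
  using gradient_Euc_inner[OF differentiableI[OF has_derivative_constraint]]
    D_eqI[OF has_derivative_constraint] by metis

text \<open>The constraints are quadratic, so their second derivative does not depend on the
  point.\<close>

lemma D_D_constraint: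
  "D (\<lambda>N. D (constraint c) N V) M U = (sform V U + sform U V) $ pos_row c $ pos_col c"
proof -
  have *: "bounded_linear (\<lambda>K :: 'a mat2. K $ pos_row c $ pos_col c)"
    by (rule bounded_linear_compose[OF bounded_linear_vec_nth bounded_linear_vec_nth])
  have "((\<lambda>N. sform V N + sform N V) has_derivative (\<lambda>U. sform V U + sform U V)) (at M)"
    by (intro has_derivative_add bounded_linear.has_derivative[OF sform.bounded_linear_right]
        bounded_linear.has_derivative[OF sform.bounded_linear_left] has_derivative_ident)
  from D_eqI[OF bounded_linear.has_derivative[OF * this]]
  show ?thesis unfolding D_eqI[OF has_derivative_constraint] .
qed

text \<open>The matrix on the right is skew-symmetric, hence zero as soon as its entries at the
  constraint positions are.\<close>

lemma normal_orthogonal_iff: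
  "(\<forall>c. normal c M \<bullet> U = 0) \<longleftrightarrow> sform U M + sform M U = 0"
proof
  assume "\<forall>c. normal c M \<bullet> U = 0"
  then have "(sform U M + sform M U) $ pos_row c $ pos_col c = 0" for c by (simp only: normal_inner)
  moreover have "(sform U M + sform M U) $ q $ p = - (sform U M + sform M U) $ p $ q" for p q
    using sform_swap[of U M q p] sform_swap[of M U q p] by simp
  ultimately show "sform U M + sform M U = 0" by (intro skew_eq_0I)
qed (simp add: normal_inner)

text \<open>The gradients of the constraints at a symplectic \<open>M\<close> have a dual system, since \<open>M\<^sup>T J M = J\<close>
  makes \<open>U \<mapsto> U\<^sup>T J M + M\<^sup>T J U\<close> a surjection onto the skew-symmetric matrices.\<close>

lemma normal_dual:
  assumes "M \<in> Sp"
  obtains U where "\<And>c. normal c M \<bullet> U = s c"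
proof -
  \<comment> \<open>As M^T J M = J, the pairing of \<open>M\<close> with \<open>U\<close> is J times
    the second factor; J^2 = -1 turns this into half of \<open>skew_fill s\<close>, and the swapped
    pairing supplies the other half.\<close>
  define U where "U = M ** ((-1/2) *\<^sub>R (J_mat ** skew_fill s))"
  have "sform M U = sform (M ** mat 1) U" by simp
  also have "\<dots> = J_mat ** ((-1/2) *\<^sub>R (J_mat ** skew_fill s))"
    using assms unfolding U_def sform_mult by (simp add: Sp_iff transpose_mat)
  also have "\<dots> = (1/2) *\<^sub>R skew_fill s"
    by (simp only: matrix_mult.scaleR_right matrix_mul_assoc J_mat_square matrix_mult.minus_left
        matrix_mul_lid) simp
  finally have MU: "sform M U = (1/2) *\<^sub>R skew_fill s" .
  have "normal c M \<bullet> U = s c" for c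
    using skew_fill_skew[of s "pos_row c" "pos_col c"]
    by (simp add: normal_inner sform_swap[of U M] MU)
  then show ?thesis by (rule that)
qed

section \<open>Orthogonal projection by Cramer's rule\<close>

definition gram :: "'n::{finite,linorder} mat2 \<Rightarrow> real ^ 'n constraint_index ^ 'n constraint_index" where
  "gram M = (\<chi> p q. normal q M \<bullet> normal p M)"

text \<open>The formula of the multipliers with \<open>W\<close> in place of the gradient of G: the
  projection and the multipliers thus share one expression, which is a quotient of determinants and
  so smooth wherever the Gram determinant is nonzero.\<close>

definition normal_coef :: "'n::{finite,linorder} mat2 \<Rightarrow> 'n mat2 \<Rightarrow> 'n constraint_index \<Rightarrow> real" where
  "normal_coef M W c =
     det ((\<chi> p q. (if q = c then W else normal q M) \<bullet> normal p M)
            :: real ^ 'n constraint_index ^ 'n constraint_index) / det (gram M)"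

definition normal_part :: "'n::{finite,linorder} mat2 \<Rightarrow> 'n mat2 \<Rightarrow> 'n mat2" where
  "normal_part M W = (\<Sum>c\<in>UNIV. normal_coef M W c *\<^sub>R normal c M)"

definition tangent_part :: "'n::{finite,linorder} mat2 \<Rightarrow> 'n mat2 \<Rightarrow> 'n mat2" where
  "tangent_part M W = W - normal_part M W"

lemma multiplier_eq: "multiplier G c M = normal_coef M (gradient_Euc G M) c"
  unfolding multiplier_def normal_coef_def gram_def
  by (simp add: if_distrib[of "\<lambda>f. gradient_Euc f M"] cong: if_cong)

text \<open>A kernel vector \<open>x\<close> yields a combination \<open>w\<close> of normals
  orthogonal to every normal, hence to itself, so \<open>w = 0\<close>. Pairing \<open>w\<close>
  with a vector from the dual system then gives \<open>x \<bullet> x = 0\<close>.\<close>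

lemma det_gram_nonzero:
  assumes "M \<in> Sp"
  shows "det (gram M) \<noteq> 0"
proof -
  have "x = 0" if "gram M *v x = 0" for x
  proof -
    define w where "w = (\<Sum>q\<in>UNIV. x $ q *\<^sub>R normal q M)"
    have wp: "w \<bullet> normal p M = 0" for p
    proof -
      have "w \<bullet> normal p M = (gram M *v x) $ p"
        by (simp add: w_def inner_sum_left matrix_vector_mult_def gram_def mult.commute)
      then show ?thesis using that by simp
    qed
    have "w \<bullet> w = (\<Sum>q\<in>UNIV. x $ q * (w \<bullet> normal q M))"
      by (subst (2) w_def) (simp add: inner_sum_right)
    then have w0: "w = 0" using wp by simp
    obtain U where U: "\<And>c. normal c M \<bullet> U = x $ c" using normal_dual[OF assms, of "\<lambda>c. x $ c"] by blast
    have "w \<bullet> U = (\<Sum>q\<in>UNIV. x $ q * x $ q)" by (simp add: w_def inner_sum_left U)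
    then have "x \<bullet> x = 0" using w0 by (simp add: inner_vec_def)
    then show ?thesis by simp
  qed
  then show ?thesis
    by (metis invertible_det_nz invertible_left_inverse matrix_left_invertible_ker)
qed

text \<open>By Cramer's rule the coefficients solve the Gram system whose right side lists the
  products of \<open>W\<close> with the normals.\<close>

lemma normal_part_inner:
  assumes "det (gram M) \<noteq> 0"
  shows "normal_part M W \<bullet> normal p M = W \<bullet> normal p M"
proof -
  define b where "b = (\<chi> p. W \<bullet> normal p M)"
  have "(\<chi> c. normal_coef M W c) =
    (\<chi> c. det (\<chi> i j. if j = c then b $ i else gram M $ i $ j) / det (gram M))"
    by (simp add: normal_coef_def b_def gram_def if_distrib[of "\<lambda>x. x \<bullet> _"] cong: if_cong)
  then have "gram M *v (\<chi> c. normal_coef M W c) = b"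
    using cramer[OF assms] by blast
  then have "(gram M *v (\<chi> c. normal_coef M W c)) $ p = W \<bullet> normal p M"
    by (simp add: b_def)
  then show ?thesis
    by (simp add: normal_part_def inner_sum_left matrix_vector_mult_def gram_def mult.commute)
qed

section \<open>Tangent spaces\<close>

text \<open>The curves are defined for all times so that two of them can be multiplied pointwise.
  Closure under sums then generates the Lie algebra from simple curves.\<close>

definition identity_velocity :: "'n::finite mat2 \<Rightarrow> bool" where
  "identity_velocity A \<longleftrightarrow> (\<exists>\<gamma>. smooth_on UNIV \<gamma> \<and> range \<gamma> \<subseteq> Sp \<and> \<gamma> (0::real) = mat 1 \<and>
     (\<gamma> has_vector_derivative A) (at 0))"

lemma identity_velocity_add:
  assumes "identity_velocity A" "identity_velocity B"
  shows "identity_velocity (A + B)"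
proof -
  obtain \<gamma> where g: "smooth_on UNIV \<gamma>" "range \<gamma> \<subseteq> Sp" "\<gamma> (0::real) = mat 1"
    "(\<gamma> has_vector_derivative A) (at 0)" using assms(1) by (auto simp: identity_velocity_def)
  obtain \<delta> where d: "smooth_on UNIV \<delta>" "range \<delta> \<subseteq> Sp" "\<delta> (0::real) = mat 1"
    "(\<delta> has_vector_derivative B) (at 0)" using assms(2) by (auto simp: identity_velocity_def)
  have "((\<lambda>t. \<gamma> t ** \<delta> t) has_vector_derivative (A + B)) (at 0)"
    using matrix_mult.has_vector_derivative[OF g(4) d(4)] g(3) d(3) by (simp add: add.commute)
  moreover have "smooth_on UNIV (\<lambda>t. \<gamma> t ** \<delta> t)"
    by (intro smooth_on_bilinear[OF bounded_bilinear_matrix_mult] g d) simp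
  moreover have "\<gamma> t ** \<delta> t \<in> Sp" for t using g(2) d(2) by (intro Sp_mult) auto
  ultimately show ?thesis
    unfolding identity_velocity_def using g(3) d(3) by (intro exI[of _ "\<lambda>t. \<gamma> t ** \<delta> t"]) auto
qed

lemma identity_velocity_0: "identity_velocity 0"
  unfolding identity_velocity_def
  by (intro exI[of _ "\<lambda>_. mat 1"]) (auto simp: smooth_on_const Sp_def)

lemma identity_velocity_sum:
  "(\<And>i. i \<in> I \<Longrightarrow> identity_velocity (A i)) \<Longrightarrow> identity_velocity (\<Sum>i\<in>I. A i)"
  by (induction I rule: infinite_finite_induct)
    (auto simp: identity_velocity_0 identity_velocity_add)

definition outer :: "real ^ 'm::finite \<Rightarrow> real ^ 'm ^ 'm" where
  "outer v = (\<chi> i j. v $ i * v $ j)"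

text \<open>The velocity \<open>c v v\<^sup>T J\<close> squares to zero, and its one-parameter group of symplectic
  transvections is affine in the parameter.\<close>

lemma identity_velocity_transvection:
  fixes v :: "real ^ ('n::finite + 'n)"
  shows "identity_velocity (c *\<^sub>R (outer v ** J_mat))"
proof -
  let ?N = "c *\<^sub>R (outer v ** J_mat)"
  define \<gamma> where "\<gamma> t = mat 1 + t *\<^sub>R ?N" for t :: real
  have NJ: "transpose (outer v ** J_mat) = - (J_mat ** outer v)"
    by (simp add: matrix_transpose_mul transpose_J_mat matrix_mult.minus_left)
      (simp add: outer_def transpose_def mult.commute)
  have vJv: "(\<Sum>k\<in>UNIV. \<Sum>l\<in>UNIV. v $ k * J_mat $ k $ l * v $ l) = 0"
  proof -
    have "(\<Sum>k\<in>UNIV. \<Sum>l\<in>UNIV. v $ k * J_mat $ k $ l * v $ l)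
        = (\<Sum>k\<in>UNIV. \<Sum>l\<in>UNIV. v $ l * J_mat $ l $ k * v $ k)"
      by (rule sum.swap)
    also have "\<dots> = - (\<Sum>k\<in>UNIV. \<Sum>l\<in>UNIV. v $ k * J_mat $ k $ l * v $ l)"
    proof -
      have *: "v $ l * J_mat $ l $ k * v $ k = - (v $ k * J_mat $ k $ l * v $ l)" for k l
        by (subst J_mat_skew) simp
      show ?thesis unfolding sum_negf[symmetric] by (intro sum.cong refl) (rule *)
    qed
    finally show ?thesis by linarith
  qed
  \<comment> \<open>Every entry contains the factor v^T J v, zero by skewness of J.\<close>
  have oJo: "outer v ** J_mat ** outer v = 0"
  proof -
    have "(outer v ** J_mat ** outer v) $ i $ j
        = v $ i * v $ j * (\<Sum>l\<in>UNIV. \<Sum>k\<in>UNIV. v $ k * J_mat $ k $ l * v $ l)" for i j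
      by (simp add: matrix_matrix_mult_def outer_def sum_distrib_left sum_distrib_right mult_ac)
    also have "\<dots> i j = 0" for i j by (subst sum.swap) (simp add: vJv)
    finally show ?thesis by (simp add: vec_eq_iff)
  qed
  \<comment> \<open>These are the coefficients of t and t^2 in
    \<open>sform (\<gamma> t) (\<gamma> t)\<close>; both must vanish for \<gamma> to stay in
    \<open>Sp\<close>.\<close>
  have s1: "sform ?N (mat 1) + sform (mat 1) ?N = 0"
    by (simp add: sform.scaleR_left sform.scaleR_right)
      (simp add: sform_def transpose_mat NJ matrix_mult.minus_left matrix_mul_assoc)
  have s2: "sform ?N ?N = 0"
  proof -
    have "transpose (outer v ** J_mat) ** J_mat ** (outer v ** J_mat)
        = - (J_mat ** (outer v ** J_mat ** outer v) ** J_mat)"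
      by (simp only: NJ matrix_mult.minus_left matrix_mul_assoc)
    then show ?thesis by (simp add: sform.scaleR_left sform.scaleR_right) (simp add: sform_def oJo)
  qed
  have "sform (\<gamma> t) (\<gamma> t) = J_mat" for t
  proof -
    have "sform (P + t *\<^sub>R N) (P + t *\<^sub>R N) = sform P P
        + t *\<^sub>R (sform N P + sform P N) + (t * t) *\<^sub>R sform N N" for P N :: "'n mat2"
      by (simp add: sform.add_left sform.add_right sform.scaleR_left sform.scaleR_right
          scaleR_add_right add_ac)
    from this[of "mat 1" ?N] have "sform (\<gamma> t) (\<gamma> t) = sform (mat 1) (mat 1)
        + t *\<^sub>R (sform ?N (mat 1) + sform (mat 1) ?N) + (t * t) *\<^sub>R sform ?N ?N"
      unfolding \<gamma>_def .
    then show ?thesis unfolding s1 s2 by (simp add: sform_def transpose_mat)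
  qed
  moreover have "smooth_on UNIV \<gamma>"
    unfolding \<gamma>_def
    by (intro smooth_on_add smooth_on_scaleR smooth_on_const smooth_on_bounded_linear
        bounded_linear_ident) auto
  moreover have "(\<gamma> has_vector_derivative ?N) (at 0)"
    unfolding \<gamma>_def by (auto intro!: derivative_eq_intros)
  ultimately show ?thesis
    unfolding identity_velocity_def by (intro exI[of _ \<gamma>]) (auto simp: Sp_iff \<gamma>_def)
qed

text \<open>By polarization, the matrices \<open>v v\<^sup>T\<close> span the symmetric matrices.\<close>

lemma identity_velocity_symmetric:
  fixes S :: "'n::finite mat2"
  assumes "transpose S = S"
  shows "identity_velocity (S ** J_mat)"
proof -
  let ?e = "\<lambda>p. axis p (1::real) :: real ^ ('n + 'n)"
  \<comment> \<open>The three outer products combine to e_p e_q^T + e_q e_p^T. With the weights S_pq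
    / 2 the sum over all ordered pairs is (S + S^T) / 2.\<close>
  let ?T = "\<lambda>p q. (S $ p $ q / 2) *\<^sub>R outer (?e p + ?e q)
    + ((- S $ p $ q / 2) *\<^sub>R outer (?e p) + (- S $ p $ q / 2) *\<^sub>R outer (?e q))"
  have T: "?T p q $ i $ j = S $ p $ q / 2 * (?e p $ i * ?e q $ j + ?e q $ i * ?e p $ j)" for p q i j
    by (simp add: outer_def algebra_simps add_divide_distrib)
  have delta: "(\<Sum>p\<in>UNIV. \<Sum>q\<in>UNIV. s p q * (?e p $ i * ?e q $ j)) = s i j" for s i j
  proof -
    have "(\<Sum>q\<in>UNIV. s p q * (?e p $ i * ?e q $ j)) = (if p = i then s p j else 0)" for p
      by (simp add: axis_def if_distrib[of "\<lambda>x. _ * x"] cong: if_cong)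
    then show ?thesis by simp
  qed
  have "(\<Sum>p\<in>UNIV. \<Sum>q\<in>UNIV. ?T p q) $ i $ j = S $ i $ j" for i j
  proof -
    have "(\<Sum>p\<in>UNIV. \<Sum>q\<in>UNIV. ?T p q) $ i $ j = (\<Sum>p\<in>UNIV. \<Sum>q\<in>UNIV.
        S $ p $ q / 2 * (?e p $ i * ?e q $ j + ?e q $ i * ?e p $ j))"
      by (simp only: sum_component T)
    also have "\<dots> = S $ i $ j / 2 + S $ j $ i / 2"
    proof -
      have "(\<Sum>p\<in>UNIV. \<Sum>q\<in>UNIV. S $ p $ q / 2 * (?e q $ i * ?e p $ j)) = S $ j $ i / 2"
        by (subst sum.swap) (rule delta)
      then show ?thesis by (simp only: distrib_left sum.distrib delta)
    qed
    also have "S $ j $ i = S $ i $ j" using arg_cong[OF assms, of "\<lambda>K. K $ i $ j"] by (simp add: transpose_def)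
    finally show ?thesis by simp
  qed
  then have "S = (\<Sum>p\<in>UNIV. \<Sum>q\<in>UNIV. ?T p q)" by (simp add: vec_eq_iff)
  then have "S ** J_mat = (\<Sum>p\<in>UNIV. \<Sum>q\<in>UNIV. ?T p q) ** J_mat"
    by (rule arg_cong[where f = "\<lambda>X. X ** J_mat"])
  also have "\<dots> = (\<Sum>p\<in>UNIV. \<Sum>q\<in>UNIV. ?T p q ** J_mat)"
    by (simp only: matrix_mult.sum_left)
  also have "identity_velocity \<dots>"
    by (intro identity_velocity_sum)
      (simp only: matrix_mult.add_left matrix_mult.scaleR_left identity_velocity_add
        identity_velocity_transvection)
  finally show ?thesis .
qed

lemma Sp_curveE:
  assumes "Sp_curve \<gamma> M U"
  obtains e where "e > 0" "\<And>t. t \<in> {-e<..<e} \<Longrightarrow> \<gamma> t \<in> Sp" "\<gamma> 0 = M"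
    "(\<gamma> has_vector_derivative U) (at 0)"
  using assms unfolding Sp_curve_def image_subset_iff by (elim conjE exE) simp

lemma Sp_curve_in_Sp: "Sp_curve \<gamma> M U \<Longrightarrow> M \<in> Sp"
  by (erule Sp_curveE) force

lemma tangent_Sp_in_Sp: "U \<in> tangent_Sp M \<Longrightarrow> M \<in> Sp"
  using Sp_curve_in_Sp by (auto simp: tangent_Sp_def)

text \<open>One direction differentiates M^T J M = J along a curve. For the other, translation by
  the inverse of \<open>M\<close> moves the problem to the identity, where the equation makes A J
  symmetric, and a curve with velocity A is translated back.\<close>

lemma tangent_Sp_iff_sform:
  assumes "M \<in> Sp"
  shows "U \<in> tangent_Sp M \<longleftrightarrow> sform U M + sform M U = 0"
proof
  assume "U \<in> tangent_Sp M"
  then obtain \<gamma> where "Sp_curve \<gamma> M U" by (auto simp: tangent_Sp_def)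
  then obtain e where \<gamma>: "e > 0" "\<And>t. t \<in> {-e<..<e} \<Longrightarrow> \<gamma> t \<in> Sp" "\<gamma> 0 = M"
    "(\<gamma> has_vector_derivative U) (at 0)" by (rule Sp_curveE) blast
  have "((\<lambda>t. sform (\<gamma> t) (\<gamma> t)) has_vector_derivative (sform M U + sform U M)) (at 0)"
    using sform.has_vector_derivative[OF \<gamma>(4) \<gamma>(4)] \<gamma>(3) by simp
  moreover have "((\<lambda>t. sform (\<gamma> t) (\<gamma> t)) has_vector_derivative 0) (at 0)"
    by (rule has_vector_derivative_transform_within_open[of "\<lambda>t. J_mat" _ _ "{-e<..<e}"])
      (use \<gamma> in \<open>auto simp: Sp_iff\<close>)
  ultimately show "sform U M + sform M U = 0"
    using vector_derivative_unique_at by (fastforce simp: add.commute)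
next
  assume U: "sform U M + sform M U = 0"
  obtain M' where M': "M ** M' = mat 1" using Sp_inverse[OF assms] by blast
  define A where "A = M' ** U"
  have MA: "M ** A = U" by (simp add: A_def matrix_mul_assoc M')
  \<comment> \<open>J^2 = -1 gives S J = A, the form for which curves are available once
    \<open>S\<close> is symmetric.\<close>
  define S where "S = - (A ** J_mat)"
  have SJ: "S ** J_mat = A"
    by (simp add: S_def matrix_mult.minus_left matrix_mul_assoc[symmetric] J_mat_square
        matrix_mult.minus_right)
  have "transpose A ** J_mat + J_mat ** A = sform (M ** A) (M ** mat 1) + sform (M ** mat 1) (M ** A)"
    using assms unfolding sform_mult by (simp add: Sp_iff transpose_mat)
  then have AJ: "transpose A ** J_mat = - (J_mat ** A)"
    using U by (simp add: MA eq_neg_iff_add_eq_0)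
  have "transpose S = J_mat ** transpose A"
  proof -
    have "transpose S = - transpose (A ** J_mat)" by (simp add: S_def transpose_def vec_eq_iff)
    then show ?thesis by (simp add: matrix_transpose_mul transpose_J_mat matrix_mult.minus_left)
  qed
  \<comment> \<open>Inserting J^2 = -1 on the right produces the product A^T J, to which
    \<open>AJ\<close> applies.\<close>
  moreover have "J_mat ** transpose A = - (J_mat ** (transpose A ** J_mat) ** J_mat)"
    by (simp add: matrix_mul_assoc[symmetric] J_mat_square matrix_mult.minus_right)
  moreover have "\<dots> = S"
    by (simp add: AJ S_def matrix_mult.minus_right matrix_mult.minus_left matrix_mul_assoc J_mat_square)
  ultimately have "identity_velocity A" using identity_velocity_symmetric[of S] SJ by simp
  then obtain \<gamma> where g: "smooth_on UNIV \<gamma>" "range \<gamma> \<subseteq> Sp" "\<gamma> (0::real) = mat 1"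
    "(\<gamma> has_vector_derivative A) (at 0)" by (auto simp: identity_velocity_def)
  have "((\<lambda>t. M ** \<gamma> t) has_vector_derivative U) (at 0)"
    using bounded_linear.has_vector_derivative[OF matrix_mult.bounded_linear_right[of M] g(4)] by (simp add: MA)
  moreover have "smooth_on UNIV (\<lambda>t. M ** \<gamma> t)"
    by (intro smooth_on_bilinear[OF bounded_bilinear_matrix_mult] g smooth_on_const) simp
  then have "smooth_on {-1<..<1} (\<lambda>t. M ** \<gamma> t)" by (rule smooth_on_subset) simp
  moreover have "M ** \<gamma> t \<in> Sp" for t using g(2) assms by (intro Sp_mult) auto
  ultimately have "Sp_curve (\<lambda>t. M ** \<gamma> t) M U"
    unfolding Sp_curve_def using g(3) by (intro conjI exI[of _ 1]) auto
  then show "U \<in> tangent_Sp M" unfolding tangent_Sp_def by blast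
qed

lemma tangent_Sp_iff_normal:
  "M \<in> Sp \<Longrightarrow> U \<in> tangent_Sp M \<longleftrightarrow> (\<forall>c. U \<bullet> normal c M = 0)"
  by (simp add: tangent_Sp_iff_sform normal_orthogonal_iff[symmetric] inner_commute)

section \<open>The projection onto the tangent space\<close>

lemma tangent_part_in_tangent: "M \<in> Sp \<Longrightarrow> tangent_part M W \<in> tangent_Sp M"
  by (simp add: tangent_Sp_iff_normal tangent_part_def inner_diff_left normal_part_inner
      det_gram_nonzero)

lemma normal_part_orthogonal:
  assumes "Z \<in> tangent_Sp M"
  shows "normal_part M W \<bullet> Z = 0"
proof -
  have "normal c M \<bullet> Z = 0" for c
    using assms tangent_Sp_iff_normal[OF tangent_Sp_in_Sp[OF assms], of Z]
    by (simp add: inner_commute)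
  then show ?thesis by (simp add: normal_part_def inner_sum_left)
qed

lemma tangent_part_inner:
  assumes "Z \<in> tangent_Sp M"
  shows "tangent_part M W \<bullet> Z = W \<bullet> Z"
  using normal_part_orthogonal[OF assms] by (simp add: tangent_part_def inner_diff_left)

lemma tangent_Sp_subspace:
  fixes M :: "'n::{finite,linorder} mat2"
  shows "M \<in> Sp \<Longrightarrow> subspace (tangent_Sp M)"
  unfolding subspace_def by (simp add: tangent_Sp_iff_normal inner_add_left)

text \<open>Two tangent vectors with the same products against the tangent space have a difference
  orthogonal to itself. The linearity rules follow from this without any determinants.\<close>

lemma tangent_part_unique:
  assumes "T \<in> tangent_Sp M" "\<And>Z. Z \<in> tangent_Sp M \<Longrightarrow> T \<bullet> Z = W \<bullet> Z"
  shows "tangent_part M W = T"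
proof -
  have M: "M \<in> Sp" using assms tangent_Sp_in_Sp by blast
  let ?Z = "tangent_part M W - T"
  have Z: "?Z \<in> tangent_Sp M"
    using tangent_Sp_subspace[OF M] tangent_part_in_tangent[OF M] assms(1) by (rule subspace_diff)
  have "?Z \<bullet> ?Z = 0"
    using tangent_part_inner[OF Z, of W] assms(2)[OF Z] by (simp add: inner_diff_left)
  then show ?thesis by simp
qed

lemma tangent_part_id: "T \<in> tangent_Sp M \<Longrightarrow> tangent_part M T = T"
  by (rule tangent_part_unique) auto

lemma tangent_part_add:
  "M \<in> Sp \<Longrightarrow> tangent_part M (W + W') = tangent_part M W + tangent_part M W'"
  by (rule tangent_part_unique)
    (simp_all add: tangent_part_in_tangent tangent_Sp_subspace subspace_add inner_add_left
      tangent_part_inner)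

lemma tangent_part_scaleR:
  "M \<in> Sp \<Longrightarrow> tangent_part M (r *\<^sub>R W) = r *\<^sub>R tangent_part M W"
  by (rule tangent_part_unique)
    (simp_all add: tangent_part_in_tangent tangent_Sp_subspace subspace_scale tangent_part_inner)

lemma tangent_part_diff:
  assumes "M \<in> Sp"
  shows "tangent_part M (W - W') = tangent_part M W - tangent_part M W'"
  using tangent_part_add[OF assms, of "W - W'" W'] by simp

lemma smooth_on_normal: "open S \<Longrightarrow> smooth_on S (normal c)"
  by (simp add: smooth_on_gradient_Euc smooth_on_constraint)

lemma smooth_on_det_gram: "open S \<Longrightarrow> smooth_on S (\<lambda>M. det (gram M))"
  unfolding gram_def by (intro smooth_on_det smooth_on_inner smooth_on_normal)

lemma smooth_on_tangent_part:
  assumes S: "open S" and W: "smooth_on S W" and "\<And>N. N \<in> S \<Longrightarrow> det (gram N) \<noteq> 0"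
  shows "smooth_on S (\<lambda>N. tangent_part N (W N))"
proof -
  have "smooth_on S (\<lambda>N. if q = c then W N else normal q N)" for q c
    using W smooth_on_normal[OF S] by (cases "q = c") auto
  then show ?thesis
    unfolding tangent_part_def normal_part_def normal_coef_def
    by (intro smooth_on_diff smooth_on_sum smooth_on_scaleR smooth_on_divide smooth_on_det
        smooth_on_inner smooth_on_normal smooth_on_det_gram assms)
qed

section \<open>Derivatives along the symplectic group\<close>

text \<open>Every curve stays in \<open>S\<close> for small times, where the chain rule for the
  extension \<open>g\<close> yields a derivative that depends on the velocity alone. Uniqueness in
  the definite description also needs at least one curve, which tangency provides.\<close>

lemma deriv_Sp_eq:
  assumes U: "U \<in> tangent_Sp M" and "open S" "M \<in> S" and g: "g differentiable (at M)"
    and fg: "\<And>N. N \<in> S \<Longrightarrow> N \<in> Sp \<Longrightarrow> f N = g N"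
  shows "deriv_Sp f M U = D g M U"
proof -
  have *: "((\<lambda>t. f (\<gamma> t)) has_real_derivative D g M U) (at 0)" if curve: "Sp_curve \<gamma> M U" for \<gamma>
  proof -
    obtain e where \<gamma>: "e > 0" "\<And>t. t \<in> {-e<..<e} \<Longrightarrow> \<gamma> t \<in> Sp" "\<gamma> 0 = M"
      "(\<gamma> has_vector_derivative U) (at 0)" using curve by (rule Sp_curveE) blast
    have "isCont \<gamma> 0" using \<gamma>(4) has_vector_derivative_continuous by blast
    then have "eventually (\<lambda>t. \<gamma> t \<in> S) (nhds 0)"
      using assms(2,3) \<gamma>(3)
      by (intro topological_tendstoD[of \<gamma> M]) (auto simp: isCont_def tendsto_at_iff_tendsto_nhds)
    moreover have "eventually (\<lambda>t. t \<in> {-e<..<e}) (nhds 0)"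
      using \<gamma>(1) by (intro eventually_nhds_in_open) auto
    ultimately have ev: "eventually (\<lambda>t. f (\<gamma> t) = g (\<gamma> t)) (nhds 0)"
      by eventually_elim (use \<gamma>(2) fg in blast)
    have "(g has_derivative D g M) (at (\<gamma> 0))" using has_derivative_D[OF g] \<gamma>(3) by simp
    from has_derivative_compose[OF \<gamma>(4)[unfolded has_vector_derivative_def] this]
    have "((\<lambda>t. g (\<gamma> t)) has_real_derivative D g M U) (at 0)"
      by (rule has_derivative_imp_has_field_derivative)
        (simp add: linear_cmul[OF linear_frechet_derivative[OF g]])
    then show ?thesis using DERIV_cong_ev[OF refl ev refl] by blast
  qed
  obtain \<gamma> where "Sp_curve \<gamma> M U" using U by (auto simp: tangent_Sp_def)
  then show ?thesis
    unfolding deriv_Sp_def using * DERIV_unique by (intro the_equality) blast+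
qed

section \<open>Smooth functions and vector fields on the group\<close>

lemma smooth_on_SpE:
  assumes "smooth_on_Sp f" "M \<in> Sp"
  obtains S g where "open S" "M \<in> S" "smooth_on S g" "\<And>N. N \<in> S \<Longrightarrow> N \<in> Sp \<Longrightarrow> f N = g N"
  using assms unfolding smooth_on_Sp_def by (metis IntI)

lemma smooth_on_SpI:
  assumes "\<And>M. M \<in> Sp \<Longrightarrow>
    \<exists>S g. open S \<and> M \<in> S \<and> smooth_on S g \<and> (\<forall>N. N \<in> S \<longrightarrow> N \<in> Sp \<longrightarrow> f N = g N)"
  shows "smooth_on_Sp f"
  unfolding smooth_on_Sp_def using assms by (metis IntD1 IntD2)

lemma smooth_on_Sp_of_smooth: "smooth_on UNIV f \<Longrightarrow> smooth_on_Sp f"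
  by (rule smooth_on_SpI) (metis UNIV_I open_UNIV)

lemma smooth_on_Sp_bilinear:
  fixes f :: "'n::finite mat2 \<Rightarrow> 'b::real_normed_vector"
    and g :: "'n mat2 \<Rightarrow> 'c::real_normed_vector"
  assumes h: "bounded_bilinear h" and f: "smooth_on_Sp f" and g: "smooth_on_Sp g"
  shows "smooth_on_Sp (\<lambda>N. h (f N) (g N))"
proof (rule smooth_on_SpI)
  fix M :: "'n mat2" assume M: "M \<in> Sp"
  obtain S f' where S: "open S" "M \<in> S" "smooth_on S f'" "\<And>N. N \<in> S \<Longrightarrow> N \<in> Sp \<Longrightarrow> f N = f' N"
    using smooth_on_SpE[OF f M] by blast
  obtain T g' where T: "open T" "M \<in> T" "smooth_on T g'" "\<And>N. N \<in> T \<Longrightarrow> N \<in> Sp \<Longrightarrow> g N = g' N"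
    using smooth_on_SpE[OF g M] by blast
  have "smooth_on (S \<inter> T) (\<lambda>N. h (f' N) (g' N))"
    using S T by (intro smooth_on_bilinear[OF h]) (auto intro: smooth_on_subset)
  then show "\<exists>S k. open S \<and> M \<in> S \<and> smooth_on S k \<and> (\<forall>N. N \<in> S \<longrightarrow> N \<in> Sp \<longrightarrow> h (f N) (g N) = k N)"
    using S T by (intro exI[of _ "S \<inter> T"] exI[of _ "\<lambda>N. h (f' N) (g' N)"]) auto
qed

lemma smooth_on_Sp_add:
  fixes f :: "'n::finite mat2 \<Rightarrow> 'b::real_normed_vector"
  assumes f: "smooth_on_Sp f" and g: "smooth_on_Sp g"
  shows "smooth_on_Sp (\<lambda>N. f N + g N)"
proof (rule smooth_on_SpI)
  fix M :: "'n mat2" assume M: "M \<in> Sp"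
  obtain S f' where S: "open S" "M \<in> S" "smooth_on S f'" "\<And>N. N \<in> S \<Longrightarrow> N \<in> Sp \<Longrightarrow> f N = f' N"
    using smooth_on_SpE[OF f M] by blast
  obtain T g' where T: "open T" "M \<in> T" "smooth_on T g'" "\<And>N. N \<in> T \<Longrightarrow> N \<in> Sp \<Longrightarrow> g N = g' N"
    using smooth_on_SpE[OF g M] by blast
  have "smooth_on (S \<inter> T) (\<lambda>N. f' N + g' N)"
    using S T by (intro smooth_on_add) (auto intro: smooth_on_subset)
  then show "\<exists>S k. open S \<and> M \<in> S \<and> smooth_on S k \<and> (\<forall>N. N \<in> S \<longrightarrow> N \<in> Sp \<longrightarrow> f N + g N = k N)"
    using S T by (intro exI[of _ "S \<inter> T"] exI[of _ "\<lambda>N. f' N + g' N"]) auto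
qed

lemma vector_field_Sp_tangent: "vector_field_Sp X \<Longrightarrow> M \<in> Sp \<Longrightarrow> X M \<in> tangent_Sp M"
  by (simp add: vector_field_Sp_def)

lemma vector_field_Sp_diff:
  fixes X Y :: "'n::{finite,linorder} mat2 \<Rightarrow> 'n mat2"
  assumes "vector_field_Sp X" "vector_field_Sp Y"
  shows "vector_field_Sp (\<lambda>N. X N - Y N)"
proof -
  have "smooth_on_Sp (\<lambda>N. X N + (-1) *\<^sub>R Y N)"
    using assms unfolding vector_field_Sp_def
    by (intro smooth_on_Sp_add smooth_on_Sp_bilinear[OF bounded_bilinear_scaleR]
        smooth_on_Sp_of_smooth[OF smooth_on_const]) auto
  then show ?thesis
    using assms by (auto simp: vector_field_Sp_def tangent_Sp_subspace subspace_diff)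
qed

text \<open>The left-invariant field N A with M A = U works: for symplectic N its tangency equation
  no longer contains N, so it holds everywhere because it holds at \<open>M\<close>.\<close>

lemma vector_field_Sp_extend:
  assumes "U \<in> tangent_Sp M"
  obtains X where "vector_field_Sp X" "X M = U"
proof -
  have M: "M \<in> Sp" using tangent_Sp_in_Sp[OF assms] .
  obtain M' where M': "M ** M' = mat 1" using Sp_inverse[OF M] by blast
  define A where "A = M' ** U"
  have MA: "M ** A = U" by (simp add: A_def matrix_mul_assoc M')
  have *: "sform (N ** A) N + sform N (N ** A) = transpose A ** J_mat + J_mat ** A" if "N \<in> Sp" for N
    using sform_mult[of N A N "mat 1"] sform_mult[of N "mat 1" N A] that
    by (simp add: Sp_iff transpose_mat)
  have "N ** A \<in> tangent_Sp N" if "N \<in> Sp" for N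
    using assms that M unfolding tangent_Sp_iff_sform[OF that] tangent_Sp_iff_sform[OF M]
    by (simp add: * MA[symmetric])
  moreover have "smooth_on_Sp (\<lambda>N. N ** A)"
    by (intro smooth_on_Sp_of_smooth smooth_on_bounded_linear matrix_mult.bounded_linear_left)
  ultimately have "vector_field_Sp (\<lambda>N. N ** A)" by (simp add: vector_field_Sp_def)
  then show ?thesis using MA by (rule that)
qed

lemma field_deriv_eq:
  assumes "X M \<in> tangent_Sp M" "open S" "M \<in> S" "g differentiable (at M)"
    "\<And>N. N \<in> S \<Longrightarrow> N \<in> Sp \<Longrightarrow> f N = g N"
  shows "field_deriv X f M = D g M (X M)"
  unfolding field_deriv_def by (rule deriv_Sp_eq[OF assms])

text \<open>Taken componentwise because \<open>deriv_Sp\<close> is for real functions; in this form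
  no extension of the field has to be chosen.\<close>

definition vderiv_Sp ::
    "('n::finite mat2 \<Rightarrow> 'n mat2) \<Rightarrow> 'n mat2 \<Rightarrow> 'n mat2 \<Rightarrow> 'n mat2" where
  "vderiv_Sp Y M U = (\<Sum>b\<in>Basis. deriv_Sp (\<lambda>N. Y N \<bullet> b) M U *\<^sub>R b)"

lemma vderiv_Sp_eq:
  assumes "U \<in> tangent_Sp M" "open S" "M \<in> S" and h: "h differentiable (at M)"
    and "\<And>N. N \<in> S \<Longrightarrow> N \<in> Sp \<Longrightarrow> Y N = h N"
  shows "vderiv_Sp Y M U = D h M U"
proof -
  have "deriv_Sp (\<lambda>N. Y N \<bullet> b) M U = D h M U \<bullet> b" for b
  proof -
    have H: "((\<lambda>N. h N \<bullet> b) has_derivative (\<lambda>U. D h M U \<bullet> b)) (at M)"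
      by (rule has_derivative_inner_left[OF has_derivative_D[OF h]])
    have "deriv_Sp (\<lambda>N. Y N \<bullet> b) M U = D (\<lambda>N. h N \<bullet> b) M U"
      by (rule deriv_Sp_eq[OF assms(1-3) differentiableI[OF H]]) (simp add: assms(5))
    then show ?thesis by (simp add: D_eqI[OF H])
  qed
  then show ?thesis by (simp add: vderiv_Sp_def euclidean_representation)
qed

section \<open>The Levi-Civita connection\<close>

definition proj_conn ::
    "('n::{finite,linorder} mat2 \<Rightarrow> 'n mat2) \<Rightarrow> ('n mat2 \<Rightarrow> 'n mat2) \<Rightarrow> 'n mat2 \<Rightarrow> 'n mat2" where
  "proj_conn X Y M = tangent_part M (vderiv_Sp Y M (X M))"

lemma vector_field_SpE:
  assumes "vector_field_Sp X" "M \<in> Sp"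
  obtains S h where "open S" "M \<in> S" "smooth_on S h" "\<And>N. N \<in> S \<Longrightarrow> N \<in> Sp \<Longrightarrow> X N = h N"
proof -
  have "smooth_on_Sp X" using assms by (simp add: vector_field_Sp_def)
  then show ?thesis using smooth_on_SpE[OF _ assms(2)] that by blast
qed

lemma vector_field_proj_conn:
  fixes X Y :: "'n::{finite,linorder} mat2 \<Rightarrow> 'n mat2"
  assumes X: "vector_field_Sp X" and Y: "vector_field_Sp Y"
  shows "vector_field_Sp (proj_conn X Y)"
proof -
  have "smooth_on_Sp (proj_conn X Y)"
  proof (rule smooth_on_SpI)
    fix M :: "'n mat2" assume M: "M \<in> Sp"
    obtain S g where S: "open S" "M \<in> S" "smooth_on S g" "\<And>N. N \<in> S \<Longrightarrow> N \<in> Sp \<Longrightarrow> X N = g N"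
      using vector_field_SpE[OF X M] by blast
    obtain T h where T: "open T" "M \<in> T" "smooth_on T h" "\<And>N. N \<in> T \<Longrightarrow> N \<in> Sp \<Longrightarrow> Y N = h N"
      using vector_field_SpE[OF Y M] by blast
    \<comment> \<open>Away from \<open>Sp\<close> the projection is known to be smooth only where
      the Gram determinant is nonzero; this open set contains \<open>Sp\<close>.\<close>
    define R where "R = S \<inter> T \<inter> {N. det (gram N) \<noteq> 0}"
    have "continuous_on UNIV (\<lambda>N :: 'n mat2. det (gram N))"
      by (rule smooth_on_continuous[OF smooth_on_det_gram[OF open_UNIV]])
    then have "open {N :: 'n mat2. det (gram N) \<noteq> 0}"
      by (intro open_Collect_neq continuous_on_const)
    then have R: "open R" "M \<in> R" using S T det_gram_nonzero[OF M] by (auto simp: R_def)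
    have sm: "smooth_on R g" "smooth_on R h"
      by (rule smooth_on_subset[OF S(3)] smooth_on_subset[OF T(3)]; auto simp: R_def)+
    have "smooth_on R (\<lambda>N. tangent_part N (D h N (g N)))"
      by (rule smooth_on_tangent_part[OF R(1) smooth_on_D[OF R(1) sm(2,1)]]) (simp add: R_def)
    moreover have "proj_conn X Y N = tangent_part N (D h N (g N))" if "N \<in> R" "N \<in> Sp" for N
    proof -
      have "vderiv_Sp Y N (X N) = D h N (X N)"
        using that T S by (intro vderiv_Sp_eq[of _ _ T] vector_field_Sp_tangent X)
          (auto simp: R_def smooth_on_differentiable)
      then show ?thesis using that S(4) by (simp add: proj_conn_def R_def)
    qed
    ultimately show "\<exists>S k. open S \<and> M \<in> S \<and> smooth_on S k \<and>
        (\<forall>N. N \<in> S \<longrightarrow> N \<in> Sp \<longrightarrow> proj_conn X Y N = k N)"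
      using R by blast
  qed
  then show ?thesis by (simp add: vector_field_Sp_def proj_conn_def tangent_part_in_tangent)
qed

lemma is_Levi_Civita_SpD:
  assumes "is_Levi_Civita_Sp C" "vector_field_Sp X" "vector_field_Sp Y"
  shows "vector_field_Sp (C X Y)"
    and "\<lbrakk>smooth_on_Sp f; M \<in> Sp\<rbrakk> \<Longrightarrow> field_deriv (\<lambda>N. C X Y N - C Y X N) f M =
      field_deriv X (field_deriv Y f) M - field_deriv Y (field_deriv X f) M"
    and "\<lbrakk>vector_field_Sp Z; M \<in> Sp\<rbrakk> \<Longrightarrow>
      field_deriv X (\<lambda>N. Y N \<bullet> Z N) M = C X Y M \<bullet> Z M + Y M \<bullet> C X Z M"
  using assms by (simp_all add: is_Levi_Civita_Sp_def affine_connection_Sp_def)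

text \<open>Each axiom is a rule for derivatives of local extensions followed by linearity of the
  projection. In the Leibniz rule the term along \<open>Y M\<close> is tangent, so the projection
  leaves it unchanged.\<close>

lemma affine_connection_proj_conn: "affine_connection_Sp (proj_conn :: ('n::{finite,linorder} mat2 \<Rightarrow> _) \<Rightarrow> _)"
  unfolding affine_connection_Sp_def
proof (intro conjI allI impI ballI; (elim conjE)?)
  fix X Y :: "'n mat2 \<Rightarrow> 'n mat2"
  assume "vector_field_Sp X" "vector_field_Sp Y"
  then show "vector_field_Sp (proj_conn X Y)" by (rule vector_field_proj_conn)
next
  fix X X' Y :: "'n mat2 \<Rightarrow> 'n mat2" and M :: "'n mat2"
  assume X: "vector_field_Sp X" "vector_field_Sp X'" and Y: "vector_field_Sp Y" and M: "M \<in> Sp"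
  obtain T h where T: "open T" "M \<in> T" "smooth_on T h" "\<And>N. N \<in> T \<Longrightarrow> N \<in> Sp \<Longrightarrow> Y N = h N"
    using vector_field_SpE[OF Y M] by blast
  have h: "h differentiable (at M)" using T smooth_on_differentiable by blast
  have "vderiv_Sp Y M U = D h M U" if "U \<in> tangent_Sp M" for U
    by (rule vderiv_Sp_eq[OF that T(1,2) h T(4)])
  then show "proj_conn (\<lambda>N. X N + X' N) Y M = proj_conn X Y M + proj_conn X' Y M"
    by (simp add: proj_conn_def vector_field_Sp_tangent X M tangent_Sp_subspace subspace_add
        linear_add[OF linear_frechet_derivative[OF h]] tangent_part_add)
next
  fix f :: "'n mat2 \<Rightarrow> real" and X Y :: "'n mat2 \<Rightarrow> 'n mat2" and M :: "'n mat2"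
  assume X: "vector_field_Sp X" and Y: "vector_field_Sp Y" and M: "M \<in> Sp"
  obtain T h where T: "open T" "M \<in> T" "smooth_on T h" "\<And>N. N \<in> T \<Longrightarrow> N \<in> Sp \<Longrightarrow> Y N = h N"
    using vector_field_SpE[OF Y M] by blast
  have h: "h differentiable (at M)" using T smooth_on_differentiable by blast
  have "vderiv_Sp Y M U = D h M U" if "U \<in> tangent_Sp M" for U
    by (rule vderiv_Sp_eq[OF that T(1,2) h T(4)])
  then show "proj_conn (\<lambda>N. f N *\<^sub>R X N) Y M = f M *\<^sub>R proj_conn X Y M"
    by (simp add: proj_conn_def vector_field_Sp_tangent X M tangent_Sp_subspace subspace_scale
        linear_cmul[OF linear_frechet_derivative[OF h]] tangent_part_scaleR)
next
  fix X Y Y' :: "'n mat2 \<Rightarrow> 'n mat2" and M :: "'n mat2"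
  assume X: "vector_field_Sp X" and Y: "vector_field_Sp Y" and Y': "vector_field_Sp Y'" and M: "M \<in> Sp"
  note XM = vector_field_Sp_tangent[OF X M]
  obtain S g where S: "open S" "M \<in> S" "smooth_on S g" "\<And>N. N \<in> S \<Longrightarrow> N \<in> Sp \<Longrightarrow> Y N = g N"
    using vector_field_SpE[OF Y M] by blast
  obtain T h where T: "open T" "M \<in> T" "smooth_on T h" "\<And>N. N \<in> T \<Longrightarrow> N \<in> Sp \<Longrightarrow> Y' N = h N"
    using vector_field_SpE[OF Y' M] by blast
  have d: "g differentiable (at M)" "h differentiable (at M)"
    using S T smooth_on_differentiable by blast+
  have H: "((\<lambda>N. g N + h N) has_derivative (\<lambda>U. D g M U + D h M U)) (at M)"
    by (intro has_derivative_add has_derivative_D d)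
  have "vderiv_Sp (\<lambda>N. Y N + Y' N) M (X M) = D (\<lambda>N. g N + h N) M (X M)"
    by (rule vderiv_Sp_eq[OF XM _ _ differentiableI[OF H], of "S \<inter> T"]) (use S T in auto)
  moreover have "vderiv_Sp Y M (X M) = D g M (X M)" by (rule vderiv_Sp_eq[OF XM S(1,2) d(1) S(4)])
  moreover have "vderiv_Sp Y' M (X M) = D h M (X M)" by (rule vderiv_Sp_eq[OF XM T(1,2) d(2) T(4)])
  ultimately show "proj_conn X (\<lambda>N. Y N + Y' N) M = proj_conn X Y M + proj_conn X Y' M"
    by (simp add: proj_conn_def D_eqI[OF H] tangent_part_add M)
next
  fix f :: "'n mat2 \<Rightarrow> real" and X Y :: "'n mat2 \<Rightarrow> 'n mat2" and M :: "'n mat2"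
  assume f: "smooth_on_Sp f" and X: "vector_field_Sp X" and Y: "vector_field_Sp Y" and M: "M \<in> Sp"
  note XM = vector_field_Sp_tangent[OF X M]
  obtain S g where S: "open S" "M \<in> S" "smooth_on S g" "\<And>N. N \<in> S \<Longrightarrow> N \<in> Sp \<Longrightarrow> f N = g N"
    using smooth_on_SpE[OF f M] by blast
  obtain T h where T: "open T" "M \<in> T" "smooth_on T h" "\<And>N. N \<in> T \<Longrightarrow> N \<in> Sp \<Longrightarrow> Y N = h N"
    using vector_field_SpE[OF Y M] by blast
  have d: "g differentiable (at M)" "h differentiable (at M)"
    using S T smooth_on_differentiable by blast+
  have H: "((\<lambda>N. g N *\<^sub>R h N) has_derivative (\<lambda>U. g M *\<^sub>R D h M U + D g M U *\<^sub>R h M)) (at M)"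
    by (intro has_derivative_scaleR has_derivative_D d)
  have "vderiv_Sp (\<lambda>N. f N *\<^sub>R Y N) M (X M) = D (\<lambda>N. g N *\<^sub>R h N) M (X M)"
    by (rule vderiv_Sp_eq[OF XM _ _ differentiableI[OF H], of "S \<inter> T"]) (use S T in auto)
  moreover have "vderiv_Sp Y M (X M) = D h M (X M)" by (rule vderiv_Sp_eq[OF XM T(1,2) d(2) T(4)])
  moreover have "field_deriv X f M = D g M (X M)" by (rule field_deriv_eq[of X M, OF XM S(1,2) d(1) S(4)])
  ultimately show "proj_conn X (\<lambda>N. f N *\<^sub>R Y N) M = field_deriv X f M *\<^sub>R Y M + f M *\<^sub>R proj_conn X Y M"
    using S(4)[OF S(2) M] T(4)[OF T(2) M] tangent_part_id[OF vector_field_Sp_tangent[OF Y M]]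
    by (simp add: proj_conn_def D_eqI[OF H] tangent_part_add tangent_part_scaleR M add.commute)
qed

text \<open>Near \<open>M\<close> the function Y f agrees on \<open>Sp\<close> with a derivative of
  the extension \<open>g\<close> along \<open>h\<close>, so \<open>D_D_field\<close>
  applies.\<close>

lemma field_deriv_field_deriv:
  assumes X: "vector_field_Sp X" and Y: "vector_field_Sp Y" and M: "M \<in> Sp"
    and S: "open S" "M \<in> S" "smooth_on S g" "\<And>N. N \<in> S \<Longrightarrow> N \<in> Sp \<Longrightarrow> f N = g N"
    and T: "open T" "M \<in> T" "smooth_on T h" "\<And>N. N \<in> T \<Longrightarrow> N \<in> Sp \<Longrightarrow> Y N = h N"
  shows "field_deriv X (field_deriv Y f) M
    = D (\<lambda>N. D g N (Y M)) M (X M) + D g M (D h M (X M))"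
proof -
  have H: "((\<lambda>N. D g N (h N)) has_derivative (\<lambda>U. D (\<lambda>N. D g N (h M)) M U + D g M (D h M U))) (at M)"
    using smooth_on_differentiable[OF T(3,2)] by (rule D_D_field[OF S(1,3,2)])
  have "field_deriv Y f N = D g N (h N)" if "N \<in> S \<inter> T" "N \<in> Sp" for N
    using field_deriv_eq[of Y N S g f, OF vector_field_Sp_tangent[OF Y that(2)] S(1)] that S T
      smooth_on_differentiable[OF S(3), of N] by simp
  then have "field_deriv X (field_deriv Y f) M = D (\<lambda>N. D g N (h N)) M (X M)"
    using S T by (intro field_deriv_eq[of X M "S \<inter> T",
        OF vector_field_Sp_tangent[OF X M] _ _ differentiableI[OF H]]) auto
  then show ?thesis using T(4)[OF T(2) M] by (simp add: D_eqI[OF H])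
qed

text \<open>Tangency makes the derivative of the constraint along Y vanish on \<open>Sp\<close>.
  Differentiating this along \<open>U\<close> shows that the normal component of the derivative of Y
  depends only on \<open>U\<close> and \<open>Y M\<close>, and symmetrically.\<close>

lemma normal_inner_D_field:
  fixes Y :: "'n::{finite,linorder} mat2 \<Rightarrow> 'n mat2"
  assumes U: "U \<in> tangent_Sp M" and Y: "vector_field_Sp Y"
    and T: "open T" "M \<in> T" "smooth_on T h" "\<And>N. N \<in> T \<Longrightarrow> N \<in> Sp \<Longrightarrow> Y N = h N"
  shows "normal c M \<bullet> D h M U = - ((sform U (Y M) + sform (Y M) U) $ pos_row c $ pos_col c)"
proof -
  have M: "M \<in> Sp" using U by (rule tangent_Sp_in_Sp)
  have F: "smooth_on UNIV (constraint c)" by (rule smooth_on_constraint) simp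
  have gr: "D (constraint c) N V = V \<bullet> normal c N" for N V
    using gradient_Euc_inner[OF smooth_on_differentiable[OF F], of N V] by (simp add: inner_commute)
  have H: "((\<lambda>N. D (constraint c) N (h N)) has_derivative
      (\<lambda>U. D (\<lambda>N. D (constraint c) N (h M)) M U + D (constraint c) M (D h M U))) (at M)"
    by (rule D_D_field[OF open_UNIV F UNIV_I]) (rule smooth_on_differentiable[OF T(3,2)])
  have "D (constraint c) N (h N) = 0" if "N \<in> T" "N \<in> Sp" for N
    using vector_field_Sp_tangent[OF Y that(2)] tangent_Sp_iff_normal[OF that(2)] T(4)[OF that]
    by (simp add: gr)
  \<comment> \<open>The zero function on \<open>Sp\<close> is computed with two extensions, the
    derivative of the constraint along \<open>h\<close> and the constant 0.\<close>
  then have "deriv_Sp (\<lambda>_. 0) M U = D (\<lambda>N. D (constraint c) N (h N)) M U"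
    by (intro deriv_Sp_eq[OF U T(1,2) differentiableI[OF H]]) simp
  moreover have "deriv_Sp (\<lambda>_. 0) M U = D (\<lambda>_. 0 :: real) M U"
    by (rule deriv_Sp_eq[OF U T(1,2)]) auto
  ultimately have "D (\<lambda>N. D (constraint c) N (h M)) M U + D (constraint c) M (D h M U) = 0"
    by (simp add: D_eqI[OF H])
  then show ?thesis
    unfolding D_D_constraint T(4)[OF T(2) M] by (simp add: gr inner_commute)
qed

text \<open>For torsion, the derivatives of Y along X and of X along Y have equal normal components,
  so their difference is tangent and survives projection; the second derivatives of f cancel by
  symmetry. For the metric axiom, pairing with tangent vectors ignores the normal parts left
  out.\<close>

lemma Levi_Civita_proj_conn: "is_Levi_Civita_Sp (proj_conn :: ('n::{finite,linorder} mat2 \<Rightarrow> _) \<Rightarrow> _)"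
  unfolding is_Levi_Civita_Sp_def
proof (intro conjI allI impI ballI; (elim conjE)?)
  show "affine_connection_Sp (proj_conn :: ('n mat2 \<Rightarrow> _) \<Rightarrow> _)" by (rule affine_connection_proj_conn)
next
  fix X Y :: "'n mat2 \<Rightarrow> 'n mat2" and f :: "'n mat2 \<Rightarrow> real" and M :: "'n mat2"
  assume X: "vector_field_Sp X" and Y: "vector_field_Sp Y" and f: "smooth_on_Sp f" and M: "M \<in> Sp"
  note XM = vector_field_Sp_tangent[OF X M] and YM = vector_field_Sp_tangent[OF Y M]
  obtain R k where R: "open R" "M \<in> R" "smooth_on R k" "\<And>N. N \<in> R \<Longrightarrow> N \<in> Sp \<Longrightarrow> f N = k N"
    using smooth_on_SpE[OF f M] by blast
  obtain S g where S: "open S" "M \<in> S" "smooth_on S g" "\<And>N. N \<in> S \<Longrightarrow> N \<in> Sp \<Longrightarrow> X N = g N"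
    using vector_field_SpE[OF X M] by blast
  obtain T h where T: "open T" "M \<in> T" "smooth_on T h" "\<And>N. N \<in> T \<Longrightarrow> N \<in> Sp \<Longrightarrow> Y N = h N"
    using vector_field_SpE[OF Y M] by blast
  have d: "k differentiable (at M)" "g differentiable (at M)" "h differentiable (at M)"
    using R S T smooth_on_differentiable by blast+
  \<comment> \<open>The Lie bracket of \<open>X\<close> and \<open>Y\<close> at \<open>M\<close>,
    written with local extensions.\<close>
  let ?B = "D h M (X M) - D g M (Y M)"
  have "normal c M \<bullet> ?B = 0" for c
    using normal_inner_D_field[OF XM Y T, of c] normal_inner_D_field[OF YM X S, of c]
    by (simp add: inner_diff_right add.commute)
  then have B: "?B \<in> tangent_Sp M" by (simp add: tangent_Sp_iff_normal[OF M] inner_commute)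
  have vd: "vderiv_Sp Y M (X M) = D h M (X M)" "vderiv_Sp X M (Y M) = D g M (Y M)"
    by (rule vderiv_Sp_eq[OF XM T(1,2) d(3) T(4)] vderiv_Sp_eq[OF YM S(1,2) d(2) S(4)]; assumption)+
  have conn: "proj_conn X Y M - proj_conn Y X M = ?B"
    using tangent_part_id[OF B] by (simp add: proj_conn_def vd tangent_part_diff[OF M])
  have "field_deriv (\<lambda>N. proj_conn X Y N - proj_conn Y X N) f M = D k M ?B"
    using field_deriv_eq[of "\<lambda>N. proj_conn X Y N - proj_conn Y X N" M, OF _ R(1,2) d(1) R(4)] B conn
    by simp
  also have "\<dots> = D k M (D h M (X M)) - D k M (D g M (Y M))"
    by (rule linear_diff[OF linear_frechet_derivative[OF d(1)]])
  also have "\<dots> = field_deriv X (field_deriv Y f) M - field_deriv Y (field_deriv X f) M"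
    using D_D_symmetric[OF R(1,3,2), of "Y M" "X M"]
    by (simp add: field_deriv_field_deriv[OF X Y M R T] field_deriv_field_deriv[OF Y X M R S])
  finally show "field_deriv (\<lambda>N. proj_conn X Y N - proj_conn Y X N) f M =
    field_deriv X (field_deriv Y f) M - field_deriv Y (field_deriv X f) M" .
next
  fix X Y Z :: "'n mat2 \<Rightarrow> 'n mat2" and M :: "'n mat2"
  assume X: "vector_field_Sp X" and Y: "vector_field_Sp Y" and Z: "vector_field_Sp Z" and M: "M \<in> Sp"
  note XM = vector_field_Sp_tangent[OF X M]
  obtain S g where S: "open S" "M \<in> S" "smooth_on S g" "\<And>N. N \<in> S \<Longrightarrow> N \<in> Sp \<Longrightarrow> Y N = g N"
    using vector_field_SpE[OF Y M] by blast
  obtain T h where T: "open T" "M \<in> T" "smooth_on T h" "\<And>N. N \<in> T \<Longrightarrow> N \<in> Sp \<Longrightarrow> Z N = h N"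
    using vector_field_SpE[OF Z M] by blast
  have d: "g differentiable (at M)" "h differentiable (at M)"
    using S T smooth_on_differentiable by blast+
  have H: "((\<lambda>N. g N \<bullet> h N) has_derivative (\<lambda>U. g M \<bullet> D h M U + D g M U \<bullet> h M)) (at M)"
    by (intro has_derivative_inner has_derivative_D d)
  have 1: "field_deriv X (\<lambda>N. Y N \<bullet> Z N) M = D (\<lambda>N. g N \<bullet> h N) M (X M)"
    by (rule field_deriv_eq[of X M "S \<inter> T", OF XM _ _ differentiableI[OF H]]) (use S T in auto)
  have vd: "vderiv_Sp Y M (X M) = D g M (X M)" "vderiv_Sp Z M (X M) = D h M (X M)"
    by (rule vderiv_Sp_eq[OF XM S(1,2) d(1) S(4)] vderiv_Sp_eq[OF XM T(1,2) d(2) T(4)]; assumption)+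
  show "field_deriv X (\<lambda>N. Y N \<bullet> Z N) M = proj_conn X Y M \<bullet> Z M + Y M \<bullet> proj_conn X Z M"
    using S(4)[OF S(2) M] T(4)[OF T(2) M] 
      tangent_part_inner[OF vector_field_Sp_tangent[OF Z M], of "D g M (X M)"]
      tangent_part_inner[OF vector_field_Sp_tangent[OF Y M], of "D h M (X M)"]
    by (simp add: 1 D_eqI[OF H] proj_conn_def vd inner_commute)
qed

section \<open>Uniqueness of the Levi-Civita connection\<close>

lemma field_deriv_inner_const:
  assumes "X M \<in> tangent_Sp M"
  shows "field_deriv X (\<lambda>N. N \<bullet> B) M = X M \<bullet> B"
proof -
  have H: "((\<lambda>N. N \<bullet> B) has_derivative (\<lambda>U. U \<bullet> B)) (at M)"
    by (rule has_derivative_inner_left[OF has_derivative_ident])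
  show ?thesis
    using field_deriv_eq[of X M UNIV "\<lambda>N. N \<bullet> B", OF assms open_UNIV UNIV_I differentiableI[OF H]] by (simp add: D_eqI[OF H])
qed

text \<open>The difference of two Levi-Civita connections, paired with a third field, is symmetric in its
  first two arguments and antisymmetric in its last two, hence zero.\<close>

lemma Levi_Civita_Sp_unique:
  fixes X Y :: "'n::{finite,linorder} mat2 \<Rightarrow> 'n mat2"
  assumes P: "is_Levi_Civita_Sp P" and Q: "is_Levi_Civita_Sp Q"
    and X: "vector_field_Sp X" and Y: "vector_field_Sp Y" and M: "M \<in> Sp"
  shows "P X Y M = Q X Y M"
proof -
  define T where "T A B Z = (P A B M - Q A B M) \<bullet> Z M" for A B Z :: "'n mat2 \<Rightarrow> 'n mat2"
  have torsion: "(C A B M - C B A M) \<bullet> W =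
      field_deriv A (field_deriv B (\<lambda>N. N \<bullet> W)) M - field_deriv B (field_deriv A (\<lambda>N. N \<bullet> W)) M"
    if C: "is_Levi_Civita_Sp C" and A: "vector_field_Sp A" and B: "vector_field_Sp B" for C A B W
  proof -
    \<comment> \<open>Linear test functions turn the torsion axiom, an identity of derivations, into
      an identity of vectors.\<close>
    have "smooth_on_Sp (\<lambda>N :: 'n mat2. N \<bullet> W)"
      by (intro smooth_on_Sp_of_smooth smooth_on_bounded_linear bounded_linear_inner_left)
    then have "field_deriv (\<lambda>N. C A B N - C B A N) (\<lambda>N. N \<bullet> W) M =
      field_deriv A (field_deriv B (\<lambda>N. N \<bullet> W)) M - field_deriv B (field_deriv A (\<lambda>N. N \<bullet> W)) M"
      by (rule is_Levi_Civita_SpD(2)[OF C A B _ M])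
    moreover have "vector_field_Sp (\<lambda>N. C A B N - C B A N)"
      by (intro vector_field_Sp_diff is_Levi_Civita_SpD(1)[OF C] A B)
    then have "C A B M - C B A M \<in> tangent_Sp M"
      using vector_field_Sp_tangent M by blast
    ultimately show ?thesis using field_deriv_inner_const[of "\<lambda>N. C A B N - C B A N" M W] by simp
  qed
  have sym: "T A B Z = T B A Z" if "vector_field_Sp A" "vector_field_Sp B" for A B Z
    using torsion[OF P that, of "Z M"] torsion[OF Q that, of "Z M"]
    by (simp add: T_def inner_diff_left)
  have metric: "field_deriv A (\<lambda>N. B N \<bullet> Z N) M = C A B M \<bullet> Z M + B M \<bullet> C A Z M"
    if "is_Levi_Civita_Sp C" "vector_field_Sp A" "vector_field_Sp B" "vector_field_Sp Z" for C A B Z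
    by (rule is_Levi_Civita_SpD(3)[OF that M])
  have skew: "T A B Z = - T A Z B"
    if "vector_field_Sp A" "vector_field_Sp B" "vector_field_Sp Z" for A B Z
    using metric[OF P that] metric[OF Q that]
    by (simp add: T_def inner_diff_left inner_commute[of "B M"])
  \<comment> \<open>With the difference itself as third field, \<open>T X Y Z\<close> is a squared
    norm.\<close>
  define Z where "Z = (\<lambda>N. P X Y N - Q X Y N)"
  have Z: "vector_field_Sp Z" unfolding Z_def 
    by (intro vector_field_Sp_diff is_Levi_Civita_SpD(1)[OF P] is_Levi_Civita_SpD(1)[OF Q] X Y)
  \<comment> \<open>Symmetry and skewness alternate, three times each; the odd number of signs
    returns \<open>T X Y Z\<close> as its own negative.\<close>
  have "T X Y Z = T Y X Z" by (rule sym[OF X Y])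
  also have "\<dots> = - T Y Z X" by (rule skew[OF Y X Z])
  also have "\<dots> = - T Z Y X" by (simp add: sym[OF Y Z])
  also have "\<dots> = T Z X Y" by (simp add: skew[OF Z Y X])
  also have "\<dots> = T X Z Y" by (rule sym[OF Z X])
  also have "\<dots> = - T X Y Z" by (rule skew[OF X Z Y])
  finally have "Z M \<bullet> Z M = 0" by (simp add: T_def Z_def)
  then show ?thesis by (simp add: Z_def)
qed

lemma Levi_Civita_Sp_eq:
  fixes X Y :: "'n::{finite,linorder} mat2 \<Rightarrow> 'n mat2"
  assumes "vector_field_Sp X" "vector_field_Sp Y" "M \<in> Sp"
  shows "Levi_Civita_Sp X Y M = proj_conn X Y M"
proof -
  have "is_Levi_Civita_Sp (Levi_Civita_Sp :: ('n mat2 \<Rightarrow> _) \<Rightarrow> _)"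
    unfolding Levi_Civita_Sp_def by (rule someI[of is_Levi_Civita_Sp, OF Levi_Civita_proj_conn])
  then show ?thesis using Levi_Civita_Sp_unique Levi_Civita_proj_conn assms by blast
qed

section \<open>The Hessian\<close>

text \<open>Pairing with a normal vector sees only the normal part, so \<open>V\<close> may be
  replaced by its own normal part, which is then expanded in the normals.\<close>

lemma normal_part_inner_eq:
  assumes "M \<in> Sp"
  shows "V \<bullet> normal_part M W = (\<Sum>c\<in>UNIV. normal_coef M V c * (normal c M \<bullet> W))"
proof -
  note np = normal_part_inner[OF det_gram_nonzero[OF assms]]
  have "V \<bullet> normal_part M W = normal_part M V \<bullet> normal_part M W"
    by (subst (1 2) normal_part_def[of M W]) (simp only: inner_sum_right inner_scaleR_right np)
  also have "\<dots> = (\<Sum>c\<in>UNIV. normal_coef M V c * (normal c M \<bullet> normal_part M W))"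
    by (subst normal_part_def[of M V]) (simp only: inner_sum_left inner_scaleR_left)
  also have "\<dots> = (\<Sum>c\<in>UNIV. normal_coef M V c * (normal c M \<bullet> W))"
    using np[of W] by (simp add: inner_commute)
  finally show ?thesis .
qed

theorem theorem3p1:
  fixes Gt G :: "'n::{finite,linorder} mat2 \<Rightarrow> real"
    and M U V :: "'n mat2"
  assumes "smooth_on_Sp Gt"
    and "smooth_on UNIV G"
    and "\<forall>N\<in>Sp. G N = Gt N"
    and "M \<in> Sp"
    and "U \<in> tangent_Sp M" and "V \<in> tangent_Sp M"
  shows "Hess_Sp Gt M U V = Hess_Euc G M U V - kronecker_form (Sigma_tilde G M) J_mat U V"
proof -
  note G = assms(2) and M = assms(4) and U = assms(5) and V = assms(6)
  let ?rhs = "Hess_Euc G M U V - kronecker_form (Sigma_tilde G M) J_mat U V"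
  have Gt: "Gt N = G N" if "N \<in> UNIV" "N \<in> Sp" for N using assms(3) that by simp
  have dG: "G differentiable (at M)" by (rule smooth_on_differentiable[OF G UNIV_I])
  \<comment> \<open>The value is the same for all admissible fields, as the definite description in
    \<open>Hess_Sp\<close> requires.\<close>
  have val: "field_deriv X (field_deriv Y Gt) M - field_deriv (Levi_Civita_Sp X Y) Gt M = ?rhs"
    if X: "vector_field_Sp X" and Y: "vector_field_Sp Y" and XY: "X M = U" "Y M = V" for X Y
  proof -
    obtain T h where T: "open T" "M \<in> T" "smooth_on T h" "\<And>N. N \<in> T \<Longrightarrow> N \<in> Sp \<Longrightarrow> Y N = h N"
      using vector_field_SpE[OF Y M] by blast
    let ?W = "D h M U"
    have "Levi_Civita_Sp X Y M = tangent_part M ?W"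
      using vderiv_Sp_eq[OF U T(1,2) smooth_on_differentiable[OF T(3,2)] T(4)]
      by (simp add: Levi_Civita_Sp_eq[OF X Y M] proj_conn_def XY)
    then have "field_deriv (Levi_Civita_Sp X Y) Gt M = D G M (tangent_part M ?W)"
      using field_deriv_eq[of "Levi_Civita_Sp X Y" M, OF _ open_UNIV UNIV_I dG Gt]
        tangent_part_in_tangent[OF M, of ?W] by simp
    also have "\<dots> = D G M ?W - D G M (normal_part M ?W)"
      unfolding tangent_part_def by (rule linear_diff[OF linear_frechet_derivative[OF dG]])
    finally have conn: "field_deriv (Levi_Civita_Sp X Y) Gt M = \<dots>" .
    have "D G M (normal_part M ?W) = gradient_Euc G M \<bullet> normal_part M ?W"
      by (rule gradient_Euc_inner[OF dG, symmetric])
    also have "\<dots> = (\<Sum>c\<in>UNIV. multiplier G c M * (normal c M \<bullet> ?W))"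
      by (simp add: normal_part_inner_eq[OF M] multiplier_eq)
    also have "\<dots> = - kronecker_form (Sigma_tilde G M) J_mat U V"
      by (simp add: normal_inner_D_field[OF U Y T] XY Sigma_tilde_eq kronecker_form_J_skew_fill
          sum_negf[symmetric] algebra_simps)
    finally have "D G M (normal_part M ?W) = - kronecker_form (Sigma_tilde G M) J_mat U V" .
    \<comment> \<open>The derivative of G along \<open>?W\<close> occurs in both terms and cancels;
      the second derivative left over has \<open>V\<close> as inner direction, as in
      \<open>Hess_Euc\<close>.\<close>
    with conn show ?thesis
      using field_deriv_field_deriv[OF X Y M open_UNIV UNIV_I G Gt T] by (simp add: XY Hess_Euc_def)
  qed
  \<comment> \<open>Fields with these values must exist; otherwise every number would satisfy the
    description vacuously.\<close>
  obtain X where X: "vector_field_Sp X" "X M = U" using vector_field_Sp_extend[OF U] by blast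
  obtain Y where Y: "vector_field_Sp Y" "Y M = V" using vector_field_Sp_extend[OF V] by blast
  show ?thesis
    unfolding Hess_Sp_def
  proof (rule the_equality)
    show "\<forall>X Y. vector_field_Sp X \<and> vector_field_Sp Y \<and> X M = U \<and> Y M = V \<longrightarrow>
      ?rhs = field_deriv X (field_deriv Y Gt) M - field_deriv (Levi_Civita_Sp X Y) Gt M"
      using val by simp
    show "h = ?rhs" if "\<forall>X Y. vector_field_Sp X \<and> vector_field_Sp Y \<and> X M = U \<and> Y M = V \<longrightarrow>
      h = field_deriv X (field_deriv Y Gt) M - field_deriv (Levi_Civita_Sp X Y) Gt M" for h
      using that X Y val[OF X(1) Y(1) X(2) Y(2)] by simp
  qed
qed

end
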